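(* Let $(M,g)$ be a smooth Riemannian manifold of dimension $n>1$ and constant sectional curvature $c$. Let $A>0$ be a real constant and let $\lambda,\mu:[0,\infty)\to\mathbb{R}$ be smooth functions such that, for all $t\ge0$, $$\lambda>0,\qquad \frac{A^2-2ct\lambda^2}{\lambda+2t\lambda'}>0,\qquad \lambda+2t\mu>0.$$ Let $(G,J)$ be the Hermitian structure on $T^*M$ defined by $$J\frac{\delta}{\delta q^i}=J^{(1)}_{ij}\frac{\partial}{\partial p_j},\qquad J\frac{\partial}{\partial p_i}=-J_{(2)}^{ij}\frac{\delta}{\delta q^j},$$ $$J^{(1)}_{ij}=\frac{A}{\lambda}g_{ij}-\frac{c\lambda^3+A^2\lambda'}{A\lambda(\lambda+2t\lambda')}p_ip_j,\qquad J_{(2)}^{ij}=\frac{\lambda}{A}g^{ij}+\frac{c\lambda^3+A^2\lambda'}{A(A^2-2ct\lambda^2)}g^{0i}g^{0j},$$ $$G\Big(\frac{\delta}{\delta q^i},\frac{\delta}{\delta q^j}\Big)=c_1g_{ij}+d_1p_ip_j,\qquad G\Big(\frac{\partial}{\partial p_i},\frac{\partial}{\partial p_j}\Big)=c_2g^{ij}+d_2g^{0i}g^{0j},\qquad G\Big(\frac{\partial}{\partial p_i},\frac{\delta}{\delta q^j}\Big)=0,$$ where $$c_1=A,\quad c_2=\frac{\lambda^2}{A},\quad d_1=\frac{-(c\lambda^3+A^2\lambda')+\mu(A^2-2ct\lambda^2)}{A(\lambda+2t\lambda')},\quad d_2=\frac{\lambda(c\lambda^3+A^2\lambda')+\mu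 A^2(\lambda+2t\lambda')}{A(A^2-2ct\lambda^2)}.$$ Then $(G,J)$ is K\"ahler if and only if $\mu=\lambda'$.
   Context: Let $\pi:T^*M\to M$ be the cotangent bundle of $M$. A local chart $(U,x^1,\dots,x^n)$ on $M$ induces the local chart $(\pi^{-1}(U),q^1,\dots,q^n,p_1,\dots,p_n)$ on $T^*M$ with $q^i=x^i\circ\pi$ and $p=p_i\,dx^i_{\pi(p)}$. The summation convention is used and all indices run over $1,\dots,n$. $g_{ij}$ are the components of $g$, $(g^{ij})$ is the inverse matrix (both evaluated at $\pi(p)$), and $g^{0i}=p_hg^{hi}$. With $\Gamma^k_{ih}$ the Christoffel symbols of $g$, put $\frac{\delta}{\delta q^i}=\frac{\partial}{\partial q^i}+p_k\Gamma^k_{ih}\frac{\partial}{\partial p_h}$; the fields $\frac{\delta}{\delta q^1},\dots,\frac{\delta}{\delta q^n},\frac{\partial}{\partial p_1},\dots,\frac{\partial}{\partial p_n}$ form a local frame on $T^*M$ (the adapted local frame). The energy density is $t=\frac12 g^{ik}(\pi(p))p_ip_k\in[0,\infty)$; functions of $t$ such as $\lambda,\mu$ and $\lambda'=d\lambda/dt$ are viewed as functions on $T^*M$ by evaluating them at the energy density. The almost complex structure $J$ is integrable and $G(JX,JY)=G(X,Y)$. The Hermitian structure $(G,J)$ is K\"ahler if its fundamental $2$-form $\phi(X,Y)=G(X,JY)$ is closed. *)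

theory Defs
  imports "HOL-Analysis.Analysis"
begin

section \<open>Smooth functions\<close>

text \<open>
  Derivatives are taken within the set, so that the definition applies both to open sets and to
  the half line \<open>{0..}\<close> (one-sided derivatives at \<open>0\<close>). In both cases the derivative is unique.
\<close>

primrec Ck_on :: "nat \<Rightarrow> 'a::euclidean_space set \<Rightarrow> ('a \<Rightarrow> 'b::real_normed_vector) \<Rightarrow> bool" where
  "Ck_on 0 S f \<longleftrightarrow> continuous_on S f"
| "Ck_on (Suc k) S f \<longleftrightarrow>
     (\<forall>x\<in>S. f differentiable (at x within S)) \<and>
     (\<forall>v. Ck_on k S (\<lambda>x. frechet_derivative f (at x within S) v))"

definition smooth_on :: "'a::euclidean_space set \<Rightarrow> ('a \<Rightarrow> 'b::real_normed_vector) \<Rightarrow> bool" where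
  "smooth_on S f \<longleftrightarrow> (\<forall>k. Ck_on k S f)"

definition half_deriv :: "(real \<Rightarrow> real) \<Rightarrow> real \<Rightarrow> real" where
  "half_deriv f t = vector_derivative f (at t within {0..})"


section \<open>Manifolds\<close>

text \<open>
  A chart is a pair of a domain and a coordinate map; the values of the map outside of the domain
  are irrelevant. Atlases need not be maximal.
\<close>

type_synonym ('m, 'e) chart = "'m set \<times> ('m \<Rightarrow> 'e)"

abbreviation chart_dom :: "('m, 'e) chart \<Rightarrow> 'm set" where
  "chart_dom \<equiv> fst"

abbreviation chart_map :: "('m, 'e) chart \<Rightarrow> 'm \<Rightarrow> 'e" where
  "chart_map \<equiv> snd"

definition chart_img :: "('m, 'e) chart \<Rightarrow> 'e set" where
  "chart_img \<kappa> = chart_map \<kappa> ` chart_dom \<kappa>"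

definition chart_inv :: "('m, 'e) chart \<Rightarrow> 'e \<Rightarrow> 'm" where
  "chart_inv \<kappa> = inv_into (chart_dom \<kappa>) (chart_map \<kappa>)"

definition carrier_of :: "('m, 'e) chart set \<Rightarrow> 'm set" where
  "carrier_of \<A> = (\<Union>\<kappa>\<in>\<A>. chart_dom \<kappa>)"

definition smooth_manifold :: "'m topology \<Rightarrow> ('m, 'e::euclidean_space) chart set \<Rightarrow> bool" where
  "smooth_manifold X \<A> \<longleftrightarrow>
     Hausdorff_space X \<and> second_countable X \<and> topspace X \<noteq> {} \<and> carrier_of \<A> = topspace X \<and>
     (\<forall>\<kappa>\<in>\<A>. openin X (chart_dom \<kappa>) \<and> open (chart_img \<kappa>) \<and>
        homeomorphic_map (subtopology X (chart_dom \<kappa>)) (top_of_set (chart_img \<kappa>)) (chart_map \<kappa>)) \<and>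
     (\<forall>\<kappa>\<in>\<A>. \<forall>\<kappa>'\<in>\<A>.
        smooth_on (chart_map \<kappa> ` (chart_dom \<kappa> \<inter> chart_dom \<kappa>')) (chart_map \<kappa>' \<circ> chart_inv \<kappa>))"

definition smooth_at :: "('m, 'e::euclidean_space) chart set \<Rightarrow> 'm \<Rightarrow> ('m \<Rightarrow> real) \<Rightarrow> bool" where
  "smooth_at \<A> x f \<longleftrightarrow>
     (\<forall>\<kappa>\<in>\<A>. x \<in> chart_dom \<kappa> \<longrightarrow>
        (\<exists>W. open W \<and> chart_map \<kappa> x \<in> W \<and> W \<subseteq> chart_img \<kappa> \<and> smooth_on W (f \<circ> chart_inv \<kappa>)))"


section \<open>Tangent and cotangent vectors\<close>

text \<open>
  Tangent vectors at \<open>x\<close> are the derivations on functions that are smooth near \<open>x\<close>, extended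
  by \<open>0\<close> to all other functions so that equality of tangent vectors is equality of functions.
  Covectors are extended by \<open>0\<close> outside of the tangent space for the same reason.
\<close>

type_synonym 'm tvec = "('m \<Rightarrow> real) \<Rightarrow> real"
type_synonym 'm covec = "'m tvec \<Rightarrow> real"

definition lincomb :: "('i::finite \<Rightarrow> real) \<Rightarrow> ('i \<Rightarrow> 'm tvec) \<Rightarrow> 'm tvec" where
  "lincomb a V = (\<lambda>f. \<Sum>i\<in>UNIV. a i * V i f)"

definition tangent_space :: "('m, 'e::euclidean_space) chart set \<Rightarrow> 'm \<Rightarrow> 'm tvec set" where
  "tangent_space \<A> x = {v.
     (\<forall>f. \<not> smooth_at \<A> x f \<longrightarrow> v f = 0) \<and>
     (\<forall>f h a b. smooth_at \<A> x f \<longrightarrow> smooth_at \<A> x h \<longrightarrow>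
        v (\<lambda>y. a * f y + b * h y) = a * v f + b * v h) \<and>
     (\<forall>f h. smooth_at \<A> x f \<longrightarrow> smooth_at \<A> x h \<longrightarrow>
        v (\<lambda>y. f y * h y) = f x * v h + h x * v f)}"

definition linear_form_on :: "'m tvec set \<Rightarrow> 'm covec \<Rightarrow> bool" where
  "linear_form_on V \<alpha> \<longleftrightarrow>
     (\<forall>v\<in>V. \<forall>w\<in>V. \<forall>a b. \<alpha> (\<lambda>f. a * v f + b * w f) = a * \<alpha> v + b * \<alpha> w)"

definition cotangent_space :: "('m, 'e::euclidean_space) chart set \<Rightarrow> 'm \<Rightarrow> 'm covec set" where
  "cotangent_space \<A> x =
     {\<alpha>. linear_form_on (tangent_space \<A> x) \<alpha> \<and> (\<forall>v. v \<notin> tangent_space \<A> x \<longrightarrow> \<alpha> v = 0)}"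

text \<open>The derivative of \<open>F\<close> at \<open>x\<close> along the constant coordinate vector field \<open>e\<close> of a chart.\<close>

definition chart_deriv :: "('m, 'e::euclidean_space) chart \<Rightarrow> ('m \<Rightarrow> real) \<Rightarrow> 'm \<Rightarrow> 'e \<Rightarrow> real" where
  "chart_deriv \<kappa> F x e = frechet_derivative (F \<circ> chart_inv \<kappa>) (at (chart_map \<kappa> x)) e"

definition coord_vec :: "('m, 'e::euclidean_space) chart set \<Rightarrow> ('m, 'e) chart \<Rightarrow> 'm \<Rightarrow> 'e \<Rightarrow> 'm tvec" where
  "coord_vec \<A> \<kappa> x e = (\<lambda>f. if smooth_at \<A> x f then chart_deriv \<kappa> f x e else 0)"

definition smooth_vector_field :: "('m, 'e::euclidean_space) chart set \<Rightarrow> ('m \<Rightarrow> 'm tvec) \<Rightarrow> bool" where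
  "smooth_vector_field \<A> V \<longleftrightarrow>
     (\<forall>x\<in>carrier_of \<A>. V x \<in> tangent_space \<A> x \<and>
        (\<forall>f. smooth_at \<A> x f \<longrightarrow> smooth_at \<A> x (\<lambda>y. V y f)))"

definition lie_bracket ::
    "('m, 'e::euclidean_space) chart set \<Rightarrow> ('m \<Rightarrow> 'm tvec) \<Rightarrow> ('m \<Rightarrow> 'm tvec) \<Rightarrow> 'm \<Rightarrow> 'm tvec" where
  "lie_bracket \<A> V W x =
     (\<lambda>f. if smooth_at \<A> x f then V x (\<lambda>y. W y f) - W x (\<lambda>y. V y f) else 0)"


section \<open>Riemannian metrics and curvature\<close>

type_synonym 'm bilin_field = "'m \<Rightarrow> 'm tvec \<Rightarrow> 'm tvec \<Rightarrow> real"

definition riemannian_metric :: "('m, 'e::euclidean_space) chart set \<Rightarrow> 'm bilin_field \<Rightarrow> bool" where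
  "riemannian_metric \<A> g \<longleftrightarrow>
     (\<forall>x\<in>carrier_of \<A>.
        (\<forall>v\<in>tangent_space \<A> x. linear_form_on (tangent_space \<A> x) (g x v)) \<and>
        (\<forall>v\<in>tangent_space \<A> x. \<forall>w\<in>tangent_space \<A> x. g x v w = g x w v) \<and>
        (\<forall>v\<in>tangent_space \<A> x. v \<noteq> (\<lambda>f. 0) \<longrightarrow> g x v v > 0)) \<and>
     (\<forall>\<kappa>\<in>\<A>. \<forall>e e'. smooth_on (chart_img \<kappa>)
        ((\<lambda>x. g x (coord_vec \<A> \<kappa> x e) (coord_vec \<A> \<kappa> x e')) \<circ> chart_inv \<kappa>))"

definition metric_mat ::
    "('m, real^'n) chart set \<Rightarrow> 'm bilin_field \<Rightarrow> ('m, real^'n) chart \<Rightarrow> 'm \<Rightarrow> real^'n^'n" where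
  "metric_mat \<A> g \<kappa> x =
     (\<chi> i j. g x (coord_vec \<A> \<kappa> x (axis i 1)) (coord_vec \<A> \<kappa> x (axis j 1)))"

definition metric_inv ::
    "('m, real^'n) chart set \<Rightarrow> 'm bilin_field \<Rightarrow> ('m, real^'n) chart \<Rightarrow> 'm \<Rightarrow> real^'n^'n" where
  "metric_inv \<A> g \<kappa> x = matrix_inv (metric_mat \<A> g \<kappa> x)"

text \<open>\<open>christoffel \<A> g \<kappa> k i j x\<close> is \<open>\<Gamma>\<^sup>k\<^sub>i\<^sub>j(x)\<close>.\<close>

definition christoffel ::
    "('m, real^'n) chart set \<Rightarrow> 'm bilin_field \<Rightarrow> ('m, real^'n) chart \<Rightarrow> 'n \<Rightarrow> 'n \<Rightarrow> 'n \<Rightarrow> 'm \<Rightarrow> real" where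
  "christoffel \<A> g \<kappa> k i j x =
     (\<Sum>h\<in>UNIV. metric_inv \<A> g \<kappa> x $ k $ h *
        (chart_deriv \<kappa> (\<lambda>y. metric_mat \<A> g \<kappa> y $ h $ j) x (axis i 1)
         + chart_deriv \<kappa> (\<lambda>y. metric_mat \<A> g \<kappa> y $ i $ h) x (axis j 1)
         - chart_deriv \<kappa> (\<lambda>y. metric_mat \<A> g \<kappa> y $ i $ j) x (axis h 1))) / 2"

text \<open>
  \<open>curvature \<A> g \<kappa> l k i j x\<close> is the \<open>l\<close>-th component of \<open>R(\<partial>\<^sub>i, \<partial>\<^sub>j)\<partial>\<^sub>k\<close>, where
  \<open>R(X, Y) = [\<nabla>\<^sub>X, \<nabla>\<^sub>Y] - \<nabla>\<^bsub>[X, Y]\<^esub>\<close>. With this sign the sectional curvature of the plane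
  spanned by \<open>X\<close> and \<open>Y\<close> is \<open>g(R(X, Y)Y, X) / (g(X, X) g(Y, Y) - g(X, Y)\<^sup>2)\<close>,
  which is positive on round spheres.
\<close>

definition curvature ::
    "('m, real^'n) chart set \<Rightarrow> 'm bilin_field \<Rightarrow> ('m, real^'n) chart \<Rightarrow> 'n \<Rightarrow> 'n \<Rightarrow> 'n \<Rightarrow> 'n \<Rightarrow> 'm \<Rightarrow> real" where
  "curvature \<A> g \<kappa> l k i j x =
     chart_deriv \<kappa> (christoffel \<A> g \<kappa> l j k) x (axis i 1)
     - chart_deriv \<kappa> (christoffel \<A> g \<kappa> l i k) x (axis j 1)
     + (\<Sum>m\<in>UNIV. christoffel \<A> g \<kappa> m j k x * christoffel \<A> g \<kappa> l i m x
                - christoffel \<A> g \<kappa> m i k x * christoffel \<A> g \<kappa> l j m x)"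

definition sectional_curvature ::
    "('m, real^'n) chart set \<Rightarrow> 'm bilin_field \<Rightarrow> ('m, real^'n) chart \<Rightarrow> 'm \<Rightarrow> real^'n \<Rightarrow> real^'n \<Rightarrow> real" where
  "sectional_curvature \<A> g \<kappa> x u v =
     (let ip = (\<lambda>a b. \<Sum>i\<in>UNIV. \<Sum>j\<in>UNIV. metric_mat \<A> g \<kappa> x $ i $ j * a $ i * b $ j);
          Rvu = (\<chi> l. \<Sum>i\<in>UNIV. \<Sum>j\<in>UNIV. \<Sum>k\<in>UNIV. curvature \<A> g \<kappa> l k i j x * u $ i * v $ j * v $ k)
      in ip Rvu u / (ip u u * ip v v - (ip u v)\<^sup>2))"

definition constant_sectional_curvature ::
    "('m, real^'n) chart set \<Rightarrow> 'm bilin_field \<Rightarrow> real \<Rightarrow> bool" where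
  "constant_sectional_curvature \<A> g c \<longleftrightarrow>
     (\<forall>\<kappa>\<in>\<A>. \<forall>x\<in>chart_dom \<kappa>. \<forall>u v. u \<noteq> v \<longrightarrow> independent {u, v} \<longrightarrow>
        sectional_curvature \<A> g \<kappa> x u v = c)"


section \<open>Hermitian and Kaehler structures\<close>

definition almost_complex_structure ::
    "('m, 'e::euclidean_space) chart set \<Rightarrow> ('m \<Rightarrow> 'm tvec \<Rightarrow> 'm tvec) \<Rightarrow> bool" where
  "almost_complex_structure \<A> J \<longleftrightarrow>
     (\<forall>x\<in>carrier_of \<A>. \<forall>v\<in>tangent_space \<A> x.
        J x v \<in> tangent_space \<A> x \<and> J x (J x v) = (\<lambda>f. - v f) \<and>
        (\<forall>w\<in>tangent_space \<A> x. \<forall>a b.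
           J x (\<lambda>f. a * v f + b * w f) = (\<lambda>f. a * J x v f + b * J x w f))) \<and>
     (\<forall>V. smooth_vector_field \<A> V \<longrightarrow> smooth_vector_field \<A> (\<lambda>x. J x (V x)))"

text \<open>Integrability is expressed by the vanishing of the Nijenhuis tensor.\<close>

definition integrable_structure ::
    "('m, 'e::euclidean_space) chart set \<Rightarrow> ('m \<Rightarrow> 'm tvec \<Rightarrow> 'm tvec) \<Rightarrow> bool" where
  "integrable_structure \<A> J \<longleftrightarrow>
     (\<forall>V W. smooth_vector_field \<A> V \<longrightarrow> smooth_vector_field \<A> W \<longrightarrow>
        (let JV = (\<lambda>x. J x (V x)); JW = (\<lambda>x. J x (W x)) in
         \<forall>x\<in>carrier_of \<A>. \<forall>f.
           lie_bracket \<A> JV JW x f - J x (lie_bracket \<A> JV W x) f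
           - J x (lie_bracket \<A> V JW x) f - lie_bracket \<A> V W x f = 0))"

definition hermitian_structure ::
    "('m, 'e::euclidean_space) chart set \<Rightarrow> 'm bilin_field \<Rightarrow> ('m \<Rightarrow> 'm tvec \<Rightarrow> 'm tvec) \<Rightarrow> bool" where
  "hermitian_structure \<A> G J \<longleftrightarrow>
     riemannian_metric \<A> G \<and> almost_complex_structure \<A> J \<and> integrable_structure \<A> J \<and>
     (\<forall>x\<in>carrier_of \<A>. \<forall>v\<in>tangent_space \<A> x. \<forall>w\<in>tangent_space \<A> x.
        G x (J x v) (J x w) = G x v w)"

definition fundamental_form :: "'m bilin_field \<Rightarrow> ('m \<Rightarrow> 'm tvec \<Rightarrow> 'm tvec) \<Rightarrow> 'm bilin_field" where
  "fundamental_form G J = (\<lambda>x v w. G x v (J x w))"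

text \<open>
  The exterior derivative of a 2-form evaluated on three constant coordinate vector fields of a
  chart. These commute, so the bracket terms of the invariant formula are absent.
\<close>

definition ext_deriv2 ::
    "('m, 'e::euclidean_space) chart set \<Rightarrow> ('m, 'e) chart \<Rightarrow> 'm bilin_field \<Rightarrow> 'm \<Rightarrow> 'e \<Rightarrow> 'e \<Rightarrow> 'e \<Rightarrow> real" where
  "ext_deriv2 \<A> \<kappa> \<phi> x a b e =
     (let comp = (\<lambda>v w y. \<phi> y (coord_vec \<A> \<kappa> y v) (coord_vec \<A> \<kappa> y w)) in
      chart_deriv \<kappa> (comp b e) x a + chart_deriv \<kappa> (comp e a) x b + chart_deriv \<kappa> (comp a b) x e)"

definition closed_form2 :: "('m, 'e::euclidean_space) chart set \<Rightarrow> 'm bilin_field \<Rightarrow> bool" where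
  "closed_form2 \<A> \<phi> \<longleftrightarrow>
     (\<forall>\<kappa>\<in>\<A>. \<forall>x\<in>chart_dom \<kappa>. \<forall>a b e. ext_deriv2 \<A> \<kappa> \<phi> x a b e = 0)"

definition kaehler ::
    "('m, 'e::euclidean_space) chart set \<Rightarrow> 'm bilin_field \<Rightarrow> ('m \<Rightarrow> 'm tvec \<Rightarrow> 'm tvec) \<Rightarrow> bool" where
  "kaehler \<A> G J \<longleftrightarrow> hermitian_structure \<A> G J \<and> closed_form2 \<A> (fundamental_form G J)"


section \<open>The cotangent bundle\<close>

type_synonym 'm cot = "'m \<times> 'm covec"

definition momentum ::
    "('m, real^'n) chart set \<Rightarrow> ('m, real^'n) chart \<Rightarrow> 'm cot \<Rightarrow> real^'n" where
  "momentum \<A> \<kappa> z = (\<chi> i. snd z (coord_vec \<A> \<kappa> (fst z) (axis i 1)))"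

definition cot_chart ::
    "('m, real^'n) chart set \<Rightarrow> ('m, real^'n) chart \<Rightarrow> ('m cot, (real^'n) \<times> (real^'n)) chart" where
  "cot_chart \<A> \<kappa> =
     ({z. fst z \<in> chart_dom \<kappa> \<and> snd z \<in> cotangent_space \<A> (fst z)},
      \<lambda>z. (chart_map \<kappa> (fst z), momentum \<A> \<kappa> z))"

definition cot_atlas ::
    "('m, real^'n) chart set \<Rightarrow> ('m cot, (real^'n) \<times> (real^'n)) chart set" where
  "cot_atlas \<A> = cot_chart \<A> ` \<A>"

text \<open>The coordinate fields \<open>\<partial>/\<partial>q\<^sup>i\<close> and \<open>\<partial>/\<partial>p\<^sub>i\<close> and the horizontal field \<open>\<delta>/\<delta>q\<^sup>i\<close>.\<close>

definition d_q :: "('m, real^'n) chart set \<Rightarrow> ('m, real^'n) chart \<Rightarrow> 'n \<Rightarrow> 'm cot \<Rightarrow> 'm cot tvec" where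
  "d_q \<A> \<kappa> i z = coord_vec (cot_atlas \<A>) (cot_chart \<A> \<kappa>) z (axis i 1, 0)"

definition d_p :: "('m, real^'n) chart set \<Rightarrow> ('m, real^'n) chart \<Rightarrow> 'n \<Rightarrow> 'm cot \<Rightarrow> 'm cot tvec" where
  "d_p \<A> \<kappa> i z = coord_vec (cot_atlas \<A>) (cot_chart \<A> \<kappa>) z (0, axis i 1)"

definition delta_q ::
    "('m, real^'n) chart set \<Rightarrow> 'm bilin_field \<Rightarrow> ('m, real^'n) chart \<Rightarrow> 'n \<Rightarrow> 'm cot \<Rightarrow> 'm cot tvec" where
  "delta_q \<A> g \<kappa> i z =
     (\<lambda>f. d_q \<A> \<kappa> i z f
        + (\<Sum>k\<in>UNIV. \<Sum>h\<in>UNIV.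
             momentum \<A> \<kappa> z $ k * christoffel \<A> g \<kappa> k i h (fst z) * d_p \<A> \<kappa> h z f))"

text \<open>\<open>g_up0 \<A> g \<kappa> z i\<close> is \<open>g\<^sup>0\<^sup>i\<close>.\<close>

definition g_up0 ::
    "('m, real^'n) chart set \<Rightarrow> 'm bilin_field \<Rightarrow> ('m, real^'n) chart \<Rightarrow> 'm cot \<Rightarrow> 'n \<Rightarrow> real" where
  "g_up0 \<A> g \<kappa> z i = (\<Sum>h\<in>UNIV. momentum \<A> \<kappa> z $ h * metric_inv \<A> g \<kappa> (fst z) $ h $ i)"

definition energy ::
    "('m, real^'n) chart set \<Rightarrow> 'm bilin_field \<Rightarrow> ('m, real^'n) chart \<Rightarrow> 'm cot \<Rightarrow> real" where
  "energy \<A> g \<kappa> z =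
     (\<Sum>i\<in>UNIV. \<Sum>k\<in>UNIV.
        metric_inv \<A> g \<kappa> (fst z) $ i $ k * momentum \<A> \<kappa> z $ i * momentum \<A> \<kappa> z $ k) / 2"


section \<open>The structure on the cotangent bundle\<close>

definition J1_coef ::
    "('m, real^'n) chart set \<Rightarrow> 'm bilin_field \<Rightarrow> real \<Rightarrow> real \<Rightarrow> (real \<Rightarrow> real) \<Rightarrow>
     ('m, real^'n) chart \<Rightarrow> 'm cot \<Rightarrow> 'n \<Rightarrow> 'n \<Rightarrow> real" where
  "J1_coef \<A> g c A lam \<kappa> z i j =
     (let t = energy \<A> g \<kappa> z; l = lam t; l' = half_deriv lam t; p = momentum \<A> \<kappa> z in
      A / l * metric_mat \<A> g \<kappa> (fst z) $ i $ j
      - (c * l^3 + A^2 * l') / (A * l * (l + 2 * t * l')) * p $ i * p $ j)"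

definition J2_coef ::
    "('m, real^'n) chart set \<Rightarrow> 'm bilin_field \<Rightarrow> real \<Rightarrow> real \<Rightarrow> (real \<Rightarrow> real) \<Rightarrow>
     ('m, real^'n) chart \<Rightarrow> 'm cot \<Rightarrow> 'n \<Rightarrow> 'n \<Rightarrow> real" where
  "J2_coef \<A> g c A lam \<kappa> z i j =
     (let t = energy \<A> g \<kappa> z; l = lam t; l' = half_deriv lam t in
      l / A * metric_inv \<A> g \<kappa> (fst z) $ i $ j
      + (c * l^3 + A^2 * l') / (A * (A^2 - 2 * c * t * l^2))
        * g_up0 \<A> g \<kappa> z i * g_up0 \<A> g \<kappa> z j)"

definition c1_coef :: "real \<Rightarrow> real" where
  "c1_coef A = A"

definition c2_coef :: "real \<Rightarrow> (real \<Rightarrow> real) \<Rightarrow> real \<Rightarrow> real" where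
  "c2_coef A lam t = (lam t)^2 / A"

definition d1_coef :: "real \<Rightarrow> real \<Rightarrow> (real \<Rightarrow> real) \<Rightarrow> (real \<Rightarrow> real) \<Rightarrow> real \<Rightarrow> real" where
  "d1_coef c A lam mu t =
     (let l = lam t; l' = half_deriv lam t in
      (- (c * l^3 + A^2 * l') + mu t * (A^2 - 2 * c * t * l^2)) / (A * (l + 2 * t * l')))"

definition d2_coef :: "real \<Rightarrow> real \<Rightarrow> (real \<Rightarrow> real) \<Rightarrow> (real \<Rightarrow> real) \<Rightarrow> real \<Rightarrow> real" where
  "d2_coef c A lam mu t =
     (let l = lam t; l' = half_deriv lam t in
      (l * (c * l^3 + A^2 * l') + mu t * A^2 * (l + 2 * t * l')) / (A * (A^2 - 2 * c * t * l^2)))"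

end

theory Submission
  imports Defs
begin

text \<open>
  Write \<open>\<theta> = p\<^sub>i dq\<^sup>i\<close> for the Liouville form of the cotangent bundle and \<open>\<phi>\<close> for the fundamental form.
  The formulas for \<open>G\<close> and \<open>J\<close> in the adapted frame give \<open>\<phi>\<close> the shape
  \<open>\<lambda> \<delta>p\<^sub>i \<and> dq\<^sup>i + \<mu> g\<^sup>0\<^sup>i p\<^sub>j \<delta>p\<^sub>i \<and> dq\<^sup>j\<close>, where \<open>\<delta>p\<^sub>h = dp\<^sub>h - p\<^sub>k \<Gamma>\<^sup>k\<^sub>i\<^sub>h dq\<^sup>i\<close>; the coefficients
  of \<open>G\<close> and \<open>J\<close> are tuned so that exactly \<open>\<lambda>\<close> and \<open>\<mu>\<close> remain (lemma
  \<open>fundamental_form_scalars\<close>). Two properties of the Levi-Civita connection remove the Christoffel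
  symbols. It is torsion free, so \<open>\<delta>p\<^sub>i \<and> dq\<^sup>i = dp\<^sub>i \<and> dq\<^sup>i = d\<theta>\<close>
  (\<open>symplectic_vertical_part\<close>), and it is metric, so the energy is constant along horizontal
  vectors and \<open>g\<^sup>0\<^sup>i \<delta>p\<^sub>i = dt\<close> (\<open>raise_vertical_part\<close>). Hence
  \<open>\<phi> = \<lambda>(t) d\<theta> + \<mu>(t) dt \<and> \<theta>\<close>, which is lemma \<open>fundamental_form_cot\<close>, and therefore
  \<open>d\<phi> = (\<lambda>'(t) - \<mu>(t)) dt \<and> d\<theta>\<close>, which is lemma \<open>ext_deriv2_cot\<close>.

  If \<open>\<mu> = \<lambda>'\<close> this vanishes. Conversely, in dimension greater than one \<open>dt \<and> d\<theta>\<close> is nonzero wherever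
  \<open>t > 0\<close> (\<open>energy_wedge_symplectic_nonzero\<close>), and every value \<open>t > 0\<close> is the energy of some
  covector; so closedness forces \<open>\<mu> = \<lambda>'\<close> on \<open>t > 0\<close>, and on \<open>t \<ge> 0\<close> by continuity.

  The computation of \<open>d\<phi>\<close> uses \<open>d(dt) = 0\<close>, that is, the symmetry of the second derivative of the
  energy as a function of the coordinates \<open>(q, p)\<close>. Closedness is tested in the charts, where only
  points of the form \<open>chart_inv K y\<close> with \<open>y = (q, p)\<close> occur. At such a point the coordinate vectors
  are tangent vectors, which makes \<open>G\<close> and \<open>J\<close> linear on them.
\<close>

section \<open>Symmetry of second derivatives\<close>

text \<open>
  The mean value theorem in the direction \<open>a\<close> turns the second difference into \<open>t\<close> times a difference of
  \<open>f'\<close> at two points that lie \<open>t b\<close> apart; differentiability of \<open>f' a\<close> at the single point \<open>x\<close> controls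
  that difference up to \<open>o(t)\<close>.
\<close>

lemma second_difference_quotient_tendsto:
  fixes f :: "'a::real_normed_vector \<Rightarrow> real"
  assumes U: "open U" "x \<in> U"
    and f: "\<And>y. y \<in> U \<Longrightarrow> (f has_derivative f' y) (at y)"
    and f'': "((\<lambda>y. f' y a) has_derivative D) (at x)"
  shows "((\<lambda>t. (f (x + t *\<^sub>R a + t *\<^sub>R b) - f (x + t *\<^sub>R a) - f (x + t *\<^sub>R b) + f x) / t\<^sup>2)
    \<longlongrightarrow> D b) (at_right 0)"
proof (rule tendstoI)
  fix \<epsilon> :: real
  assume "\<epsilon> > 0"
  define C where "C = norm a + norm b + 1"
  have C: "C > 0" using norm_ge_zero[of a] norm_ge_zero[of b] unfolding C_def by linarith
  define e where "e = \<epsilon> / (3 * C)"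
  have e: "e > 0" using C \<open>\<epsilon> > 0\<close> by (simp add: e_def)
  interpret D: bounded_linear D using f'' by (rule has_derivative_bounded_linear)
  obtain d where d: "d > 0"
    "\<And>y. norm (y - x) < d \<Longrightarrow> norm (f' y a - f' x a - D (y - x)) \<le> e * norm (y - x)"
    using f'' e unfolding has_derivative_at_alt by blast
  obtain r where r: "r > 0" "ball x r \<subseteq> U" using U open_contains_ball by blast
  define t0 where "t0 = min d r / C"
  have t0: "t0 > 0" using d(1) r(1) C by (simp add: t0_def)
  have "dist ((f (x + t *\<^sub>R a + t *\<^sub>R b) - f (x + t *\<^sub>R a) - f (x + t *\<^sub>R b) + f x) / t\<^sup>2) (D b) < \<epsilon>"
    if t: "0 < t" "t < t0" for t
  proof -
    have tC: "t * C < min d r" using t C by (simp add: t0_def field_simps)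
    have near: "norm (s *\<^sub>R a + s' *\<^sub>R b) \<le> t * C" if "0 \<le> s" "s \<le> t" "0 \<le> s'" "s' \<le> t" for s s'
    proof -
      have "norm (s *\<^sub>R a + s' *\<^sub>R b) \<le> s * norm a + s' * norm b"
        using norm_triangle_ineq[of "s *\<^sub>R a" "s' *\<^sub>R b"] that by simp
      also have "\<dots> \<le> t * norm a + t * norm b"
        using that by (intro add_mono mult_right_mono) auto
      also have "\<dots> \<le> t * C" using t by (simp add: C_def algebra_simps)
      finally show ?thesis .
    qed
    have inU: "x + (s *\<^sub>R a + s' *\<^sub>R b) \<in> U" if "0 \<le> s" "s \<le> t" "0 \<le> s'" "s' \<le> t" for s s'
    proof -
      have "dist x (x + w) = norm w" for w by (simp add: dist_norm)
      then show ?thesis using near[OF that] tC by (intro subsetD[OF r(2)]) simp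
    qed
    have der: "((\<lambda>s. f (x + (s *\<^sub>R a + s' *\<^sub>R b))) has_derivative
        (\<lambda>h. f' (x + (s *\<^sub>R a + s' *\<^sub>R b)) (h *\<^sub>R a))) (at s within S)"
      if "0 \<le> s" "s \<le> t" "0 \<le> s'" "s' \<le> t" for s s' S
    proof (rule has_derivative_compose[where g = f])
      show "((\<lambda>s. x + (s *\<^sub>R a + s' *\<^sub>R b)) has_derivative (\<lambda>h. h *\<^sub>R a)) (at s within S)"
        by (auto intro!: derivative_eq_intros)
      show "(f has_derivative f' (x + (s *\<^sub>R a + s' *\<^sub>R b))) (at (x + (s *\<^sub>R a + s' *\<^sub>R b)))"
        by (rule f) (rule inU[OF that])
    qed
    \<comment> \<open>The second difference is \<open>\<psi> t - \<psi> 0\<close>.\<close>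
    define \<psi> where "\<psi> = (\<lambda>s. f (x + (s *\<^sub>R a + t *\<^sub>R b)) - f (x + (s *\<^sub>R a + 0 *\<^sub>R b)))"
    have "(\<psi> has_derivative (\<lambda>h. f' (x + (s *\<^sub>R a + t *\<^sub>R b)) (h *\<^sub>R a)
        - f' (x + (s *\<^sub>R a + 0 *\<^sub>R b)) (h *\<^sub>R a))) (at s within {0..t})"
      if "0 \<le> s" "s \<le> t" for s
      unfolding \<psi>_def by (intro has_derivative_diff der that) (use t in auto)
    from mvt_simple[OF t(1) this] obtain s where s: "0 < s" "s < t"
      and "\<psi> t - \<psi> 0 = f' (x + (s *\<^sub>R a + t *\<^sub>R b)) (t *\<^sub>R a) - f' (x + (s *\<^sub>R a + 0 *\<^sub>R b)) (t *\<^sub>R a)"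
      by auto
    moreover have "f' (x + (s *\<^sub>R a + s' *\<^sub>R b)) (t *\<^sub>R a) = t * f' (x + (s *\<^sub>R a + s' *\<^sub>R b)) a"
      if "0 \<le> s'" "s' \<le> t" for s'
      using linear_scale[OF has_derivative_linear[OF f[OF inU]]] s that by simp
    from this[of t] this[of 0] calculation
    have "\<psi> t - \<psi> 0 = t * (f' (x + (s *\<^sub>R a + t *\<^sub>R b)) a - f' (x + (s *\<^sub>R a + 0 *\<^sub>R b)) a)"
      using t by (simp add: right_diff_distrib)
    \<comment> \<open>The error of the linear approximation of the first derivative at \<open>x\<close>.\<close>
    moreover define R where "R = (\<lambda>s'. f' (x + (s *\<^sub>R a + s' *\<^sub>R b)) a - f' x a - D (s *\<^sub>R a + s' *\<^sub>R b))"
    ultimately have eq: "\<psi> t - \<psi> 0 = t * (R t - R 0 + t * D b)"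
      by (simp add: D.add D.scaleR algebra_simps)
    have R: "\<bar>R s'\<bar> \<le> e * (t * C)" if "0 \<le> s'" "s' \<le> t" for s'
    proof -
      have "\<bar>R s'\<bar> \<le> e * norm (s *\<^sub>R a + s' *\<^sub>R b)"
        using d(2)[of "x + (s *\<^sub>R a + s' *\<^sub>R b)"] near[of s s'] tC s that by (simp add: R_def)
      also have "\<dots> \<le> e * (t * C)" using near[of s s'] s that e by (intro mult_left_mono) auto
      finally show ?thesis .
    qed
    have "(\<psi> t - \<psi> 0) / t\<^sup>2 - D b = (R t - R 0) / t"
      using t unfolding eq by (simp add: power2_eq_square field_simps)
    then have "\<bar>(\<psi> t - \<psi> 0) / t\<^sup>2 - D b\<bar> = \<bar>R t - R 0\<bar> / t"
      using t by simp
    also have "\<dots> \<le> (e * (t * C) + e * (t * C)) / t"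
      using R[of t] R[of 0] t abs_triangle_ineq4[of "R t" "R 0"]
      by (intro divide_right_mono) linarith+
    also have "\<dots> = 2 / 3 * \<epsilon>" using t C by (simp add: e_def field_simps)
    also have "\<dots> < \<epsilon>" using \<open>\<epsilon> > 0\<close> by simp
    finally show ?thesis by (simp add: \<psi>_def dist_norm algebra_simps)
  qed
  then show "\<forall>\<^sub>F t in at_right 0. dist ((f (x + t *\<^sub>R a + t *\<^sub>R b) - f (x + t *\<^sub>R a)
      - f (x + t *\<^sub>R b) + f x) / t\<^sup>2) (D b) < \<epsilon>"
    using t0 by (intro eventually_at_rightI[of 0 t0]) auto
qed

text \<open>
  The second difference is symmetric in \<open>a\<close> and \<open>b\<close>, so its limit is as well.
\<close>

lemma second_derivative_symmetric:
  fixes f :: "'a::real_normed_vector \<Rightarrow> real"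
  assumes "open U" "x \<in> U"
    and "\<And>y. y \<in> U \<Longrightarrow> (f has_derivative f' y) (at y)"
    and "\<And>v. ((\<lambda>y. f' y v) has_derivative D v) (at x)"
  shows "D a b = D b a"
proof (rule tendsto_unique[OF trivial_limit_at_right_real])
  let ?Q = "\<lambda>t. (f (x + t *\<^sub>R a + t *\<^sub>R b) - f (x + t *\<^sub>R a) - f (x + t *\<^sub>R b) + f x) / t\<^sup>2"
  show "(?Q \<longlongrightarrow> D a b) (at_right 0)"
    by (rule second_difference_quotient_tendsto[OF assms])
  show "(?Q \<longlongrightarrow> D b a) (at_right 0)"
    using second_difference_quotient_tendsto[OF assms(1-3) assms(4)[of b], of a]
    by (simp add: algebra_simps)
qed


section \<open>Differentiation of matrices\<close>

lemma matrix_eq_sum_axis: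
  "(A :: real^'n^'m) = (\<Sum>i\<in>UNIV. \<Sum>j\<in>UNIV. A $ i $ j *\<^sub>R axis i (axis j 1))"
proof -
  have "(\<Sum>j\<in>UNIV. A $ i $ j * (axis i (axis j 1) :: real^'n^'m) $ r $ s) = (if i = r then A $ i $ s else 0)" for i r s
    by (auto simp: axis_def if_distrib cong: if_cong)
  then show ?thesis by (simp add: vec_eq_iff)
qed

lemma differentiable_matrixI:
  fixes M :: "'a::real_normed_vector \<Rightarrow> real^'n^'m"
  assumes "\<And>i j. (\<lambda>x. M x $ i $ j) differentiable (at x within S)"
  shows "M differentiable (at x within S)"
proof -
  have "M = (\<lambda>x. \<Sum>i\<in>UNIV. \<Sum>j\<in>UNIV. M x $ i $ j *\<^sub>R axis i (axis j 1))"
    using matrix_eq_sum_axis by blast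
  moreover have "\<dots> differentiable (at x within S)"
    by (intro differentiable_sum differentiable_scaleR assms differentiable_const finite ballI)
  ultimately show ?thesis by simp
qed

lemma differentiable_matrix_entry:
  fixes M :: "'a::real_normed_vector \<Rightarrow> real^'n^'m"
  assumes "M differentiable (at x within S)"
  shows "(\<lambda>x. M x $ i $ j) differentiable (at x within S)"
proof -
  have "bounded_linear (\<lambda>A :: real^'n^'m. A $ i $ j)"
    using bounded_linear_compose[OF bounded_linear_vec_nth bounded_linear_vec_nth] .
  then show ?thesis
    using assms bounded_linear.has_derivative unfolding differentiable_def by blast
qed

lemma det_differentiable:
  fixes M :: "'a::real_normed_vector \<Rightarrow> real^'n^'n"
  assumes "\<And>i j. (\<lambda>x. M x $ i $ j) differentiable (at x within S)"
  shows "(\<lambda>x. det (M x)) differentiable (at x within S)"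
proof -
  have "(\<lambda>x. \<Prod>i\<in>UNIV. M x $ i $ p i) differentiable (at x within S)" for p
    using has_derivative_prod[of UNIV "\<lambda>i x. M x $ i $ p i"
      "\<lambda>i. frechet_derivative (\<lambda>x. M x $ i $ p i) (at x within S)" x S]
      assms[unfolded frechet_derivative_works] by (auto simp: differentiable_def)
  then show ?thesis unfolding det_def
    by (intro differentiable_sum differentiable_mult differentiable_const) auto
qed

lemma bounded_bilinear_matrix_mult:
  "bounded_bilinear ((**) :: real^'n^'m \<Rightarrow> real^'p^'n \<Rightarrow> real^'p^'m)"
  unfolding bilinear_conv_bounded_bilinear[symmetric] bilinear_def linear_iff
  by (simp add: matrix_matrix_mult_def vec_eq_iff algebra_simps sum.distrib sum_distrib_left)

lemma bounded_bilinear_matrix_vector_mult: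
  "bounded_bilinear ((*v) :: real^'n^'m \<Rightarrow> real^'n \<Rightarrow> real^'m)"
  unfolding bilinear_conv_bounded_bilinear[symmetric] bilinear_def linear_iff
  by (simp add: algebra_simps matrix_vector_mult_scaleR scaleR_matrix_vector_assoc)

lemma matrix_inv_inverse:
  fixes A :: "real^'n^'n"
  assumes "invertible A"
  shows "A ** matrix_inv A = mat 1" "matrix_inv A ** A = mat 1"
  using assms unfolding invertible_def matrix_inv_def by (metis (mono_tags, lifting) someI_ex)+

text \<open>
  Cramer's rule expresses the entries of the inverse as quotients of determinants.
\<close>

lemma matrix_inv_differentiable:
  fixes M :: "'a::real_normed_vector \<Rightarrow> real^'n^'n"
  assumes M: "M differentiable (at x)"
    and U: "open U" "x \<in> U" "\<And>y. y \<in> U \<Longrightarrow> invertible (M y)"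
  shows "(\<lambda>y. matrix_inv (M y)) differentiable (at x)"
proof (rule differentiable_matrixI)
  fix i j
  let ?C = "\<lambda>y. det (\<chi> r s. if s = i then axis j 1 $ r else M y $ r $ s) / det (M y)"
  have "(\<lambda>y. (\<chi> r s. if s = i then axis j 1 $ r else M y $ r $ s) $ r $ s) differentiable (at x)" for r s
    using differentiable_matrix_entry[OF M] by (cases "s = i") auto
  moreover have "det (M x) \<noteq> 0" using U invertible_det_nz by blast
  ultimately have "?C differentiable (at x)"
    by (intro differentiable_divide det_differentiable differentiable_matrix_entry[OF M]) auto
  moreover have "?C y = matrix_inv (M y) $ i $ j" if "y \<in> U" for y
  proof -
    have "M y *v (matrix_inv (M y) *v axis j 1) = axis j 1"
      by (simp add: matrix_vector_mul_assoc matrix_inv_inverse(1)[OF U(3)[OF that]])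
    then have "matrix_inv (M y) *v axis j 1 =
        (\<chi> k. det (\<chi> r s. if s = k then axis j 1 $ r else M y $ r $ s) / det (M y))"
      using cramer U(3)[OF that] invertible_det_nz by blast
    moreover have "(matrix_inv (M y) *v axis j 1) $ i = matrix_inv (M y) $ i $ j"
      by (simp add: matrix_vector_mult_def axis_def if_distrib cong: if_cong)
    ultimately show ?thesis by simp
  qed
  ultimately show "(\<lambda>y. matrix_inv (M y) $ i $ j) differentiable (at x)"
    using U unfolding differentiable_def by (metis (no_types, lifting) has_derivative_transform_within_open)
qed

text \<open>
  Once differentiability is known, the derivative is found by differentiating \<open>M M\<^sup>-\<^sup>1 = 1\<close>.
\<close>

lemma has_derivative_matrix_inv:
  fixes M :: "'a::real_normed_vector \<Rightarrow> real^'n^'n"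
  assumes M: "(M has_derivative M') (at x)"
    and U: "open U" "x \<in> U" "\<And>y. y \<in> U \<Longrightarrow> invertible (M y)"
  shows "((\<lambda>y. matrix_inv (M y)) has_derivative
    (\<lambda>v. - (matrix_inv (M x) ** M' v ** matrix_inv (M x)))) (at x)"
proof -
  let ?N = "\<lambda>y. matrix_inv (M y)"
  note inv = matrix_inv_inverse[OF U(3)]
  obtain N' where N': "(?N has_derivative N') (at x)"
    using matrix_inv_differentiable[of M x U] M U unfolding differentiable_def by blast
  have "((\<lambda>y. M y ** ?N y) has_derivative (\<lambda>v. M x ** N' v + M' v ** ?N x)) (at x)"
    by (rule bounded_bilinear.FDERIV[OF bounded_bilinear_matrix_mult M N'])
  then have "((\<lambda>y. mat 1) has_derivative (\<lambda>v. M x ** N' v + M' v ** ?N x)) (at x)"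
    by (rule has_derivative_transform_within_open[OF _ U(1,2)]) (simp add: inv)
  then have "(\<lambda>v. M x ** N' v + M' v ** ?N x) = (\<lambda>v. 0)"
    using has_derivative_unique has_derivative_const by blast
  then have 0: "M x ** N' v + M' v ** ?N x = 0" for v by meson
  have "N' v = - (?N x ** M' v ** ?N x)" for v
  proof -
    have "?N x ** (M x ** N' v + M' v ** ?N x) = N' v + ?N x ** M' v ** ?N x"
      by (simp add: matrix_add_ldistrib matrix_mul_assoc inv U)
    then show ?thesis unfolding 0 by (simp add: eq_neg_iff_add_eq_0 matrix_matrix_mult_def vec_eq_iff)
  qed
  then show ?thesis using N' by presburger
qed

section \<open>The kinetic energy of a metric in coordinates\<close>

text \<open>
  A metric in coordinates is a matrix-valued function \<open>M\<close> of \<open>q\<close>. The vector \<open>raise M (q, p)\<close> is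
  \<open>g\<^sup>0\<^sup>i\<close>, the covector \<open>p\<close> with its index raised, and \<open>kinetic\<close> is the energy density in coordinates.
\<close>

definition raise :: "(real^'n \<Rightarrow> real^'n^'n) \<Rightarrow> (real^'n) \<times> (real^'n) \<Rightarrow> real^'n" where
  "raise M z = matrix_inv (M (fst z)) *v snd z"

definition kinetic :: "(real^'n \<Rightarrow> real^'n^'n) \<Rightarrow> (real^'n) \<times> (real^'n) \<Rightarrow> real" where
  "kinetic M z = (raise M z \<bullet> snd z) / 2"

text \<open>
  The differential of the energy, written with the derivative \<open>M'\<close> of the metric itself instead of
  the derivative of its inverse; this form makes a second differentiation routine.
\<close>

definition kinetic_deriv ::
    "(real^'n \<Rightarrow> real^'n^'n) \<Rightarrow> (real^'n \<Rightarrow> real^'n \<Rightarrow> real^'n^'n) \<Rightarrow> (real^'n) \<times> (real^'n) \<Rightarrow>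
     (real^'n) \<times> (real^'n) \<Rightarrow> real" where
  "kinetic_deriv M M' z v =
     raise M z \<bullet> snd v - (raise M z \<bullet> (M' (fst z) (fst v) *v raise M z)) / 2"

lemma matrix_inv_symmetric:
  fixes A :: "real^'n^'n"
  assumes "invertible A" "transpose A = A"
  shows "transpose (matrix_inv A) = matrix_inv A"
proof -
  have "transpose (matrix_inv A) ** A = mat 1"
    using arg_cong[OF matrix_inv_inverse(1)[OF assms(1)], of transpose]
    by (simp add: matrix_transpose_mul assms transpose_mat)
  then have "transpose (matrix_inv A) ** A ** matrix_inv A = matrix_inv A" by simp
  then show ?thesis using matrix_inv_inverse(1)[OF assms(1)]
    by (simp add: matrix_mul_assoc[symmetric])
qed

context
  fixes M :: "real^'n \<Rightarrow> real^'n^'n" and M' U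
  assumes U: "open U"
    and M: "\<And>q. q \<in> U \<Longrightarrow> (M has_derivative M' q) (at q)"
    and inv: "\<And>q. q \<in> U \<Longrightarrow> invertible (M q)"
    and sym: "\<And>q. q \<in> U \<Longrightarrow> transpose (M q) = M q"
begin

lemma has_derivative_raise:
  assumes "fst z \<in> U"
  shows "(raise M has_derivative (\<lambda>v. matrix_inv (M (fst z)) *v snd v
    - matrix_inv (M (fst z)) *v (M' (fst z) (fst v) *v raise M z))) (at z)"
proof -
  let ?N = "\<lambda>q. matrix_inv (M q)"
  have "((\<lambda>z. ?N (fst z)) has_derivative (\<lambda>v. - (?N (fst z) ** M' (fst z) (fst v) ** ?N (fst z)))) (at z)"
    using has_derivative_compose[OF has_derivative_fst[OF has_derivative_ident] has_derivative_matrix_inv[OF M U]]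
      assms inv by blast
  from bounded_bilinear.FDERIV[OF bounded_bilinear_matrix_vector_mult this has_derivative_snd[OF has_derivative_ident]]
  show ?thesis unfolding raise_def
    by (simp add: matrix_vector_mul_assoc matrix_mul_assoc bounded_bilinear.minus_left[OF bounded_bilinear_matrix_vector_mult])
qed

lemma has_derivative_kinetic:
  assumes "fst z \<in> U"
  shows "(kinetic M has_derivative kinetic_deriv M M' z) (at z)"
proof -
  let ?N = "matrix_inv (M (fst z))"
  have "transpose ?N = ?N" using assms inv sym matrix_inv_symmetric by blast
  then have N: "(?N *v x) \<bullet> y = x \<bullet> (?N *v y)" for x y
    by (metis dot_lmul_matrix transpose_matrix_vector)
  have "(kinetic M has_derivative (\<lambda>v. (raise M z \<bullet> snd v
      + (?N *v snd v - ?N *v (M' (fst z) (fst v) *v raise M z)) \<bullet> snd z) / 2)) (at z)"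
    unfolding kinetic_def
    by (intro bounded_linear.has_derivative[OF bounded_linear_divide] has_derivative_inner has_derivative_raise assms has_derivative_snd has_derivative_ident)
  moreover have "(raise M z \<bullet> snd v
      + (?N *v snd v - ?N *v (M' (fst z) (fst v) *v raise M z)) \<bullet> snd z) / 2 = kinetic_deriv M M' z v" for v
    unfolding kinetic_deriv_def inner_diff_left N by (simp add: raise_def inner_commute)
  ultimately show ?thesis by simp
qed

text \<open>
  The energy inherits second derivatives from the metric, as needed for their symmetry.
\<close>

lemma kinetic_deriv_differentiable:
  assumes "fst z \<in> U" and M'': "\<And>w. (\<lambda>q. M' q w) differentiable (at (fst z))"
  shows "(\<lambda>y. kinetic_deriv M M' y v) differentiable (at z)"
proof -
  note raise = has_derivative_raise[OF assms(1)]
  obtain D where D: "((\<lambda>q. M' q (fst v)) has_derivative D) (at (fst z))"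
    using M'' unfolding differentiable_def by blast
  have "((\<lambda>y. M' (fst y) (fst v)) has_derivative (\<lambda>w. D (fst w))) (at z)"
    by (rule has_derivative_compose[OF has_derivative_fst[OF has_derivative_ident] D])
  from bounded_bilinear.FDERIV[OF bounded_bilinear_matrix_vector_mult this raise]
  show ?thesis unfolding differentiable_def kinetic_deriv_def
    by (intro exI) (rule has_derivative_diff bounded_linear.has_derivative[OF bounded_linear_divide] has_derivative_inner raise has_derivative_const | assumption)+
qed

end

lemma kinetic_nonneg:
  fixes M :: "real^'n \<Rightarrow> real^'n^'n"
  assumes "invertible (M (fst z))" and pos: "\<And>a. a \<noteq> 0 \<Longrightarrow> 0 < a \<bullet> (M (fst z) *v a)"
  shows "0 \<le> kinetic M z"
proof -
  have "M (fst z) *v raise M z = snd z"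
    by (simp add: raise_def matrix_vector_mul_assoc matrix_inv_inverse assms)
  then show ?thesis using pos[of "raise M z"] by (cases "raise M z = 0") (auto simp: kinetic_def)
qed

section \<open>Exterior derivative of a form built from the energy\<close>

text \<open>
  The value on \<open>(v, w)\<close> of the canonical form \<open>dp\<^sub>i \<and> dq\<^sup>i\<close>, the exterior derivative of the
  Liouville form.
\<close>

definition symplectic :: "(real^'n) \<times> (real^'n) \<Rightarrow> (real^'n) \<times> (real^'n) \<Rightarrow> real" where
  "symplectic v w = snd v \<bullet> fst w - fst v \<bullet> snd w"

text \<open>
  The identity \<open>d(\<lambda>(T) d\<theta> + \<mu>(T) dT \<and> \<theta>) = (\<lambda>'(T) - \<mu>(T)) dT \<and> d\<theta>\<close> in coordinates. The derivative of
  \<open>\<mu>\<close> only multiplies \<open>dT \<and> dT\<close>, and the second derivative of \<open>T\<close> drops out by symmetry. As \<open>T\<close> is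
  nonnegative and may vanish, \<open>\<lambda>\<close> and \<open>\<mu>\<close> are differentiated from the right at \<open>0\<close> only.
\<close>

lemma ext_deriv_energy_form:
  fixes T :: "(real^'n) \<times> (real^'n) \<Rightarrow> real" and z a b e
  assumes S: "open S" "z \<in> S"
    and T: "\<And>y. y \<in> S \<Longrightarrow> (T has_derivative T' y) (at y)"
    and T'': "\<And>v. (\<lambda>y. T' y v) differentiable (at z)"
    and T0: "\<And>y. y \<in> S \<Longrightarrow> T y \<ge> 0"
    and lam: "(lam has_real_derivative l') (at (T z) within {0..})"
    and mu: "(mu has_real_derivative m') (at (T z) within {0..})"
    and F: "\<And>v w y. y \<in> S \<Longrightarrow> F v w y = lam (T y) * symplectic v w
      + mu (T y) * (T' y v * (snd y \<bullet> fst w) - T' y w * (snd y \<bullet> fst v))"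
  shows "frechet_derivative (F b e) (at z) a + frechet_derivative (F e a) (at z) b
      + frechet_derivative (F a b) (at z) e
    = (l' - mu (T z)) * (T' z a * symplectic b e + T' z b * symplectic e a + T' z e * symplectic a b)"
proof -
  obtain D where D: "\<And>v. ((\<lambda>y. T' y v) has_derivative D v) (at z)"
    using T'' unfolding differentiable_def by metis
  have sym: "D v w = D w v" for v w by (rule second_derivative_symmetric[OF S T D])
  \<comment> \<open>\<open>T\<close> maps \<open>S\<close> into the half line, so one-sided derivatives suffice for the chain rule.\<close>
  have TS: "(T has_derivative T' z) (at z within S)" using T S has_derivative_at_withinI by blast
  have comp: "((\<lambda>y. f (T y)) has_derivative (\<lambda>x. f' * T' z x)) (at z)"
    if "(f has_real_derivative f') (at (T z) within {0..})" for f f'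
  proof -
    have "(f has_derivative (*) f') (at (T z) within T ` S)"
      using that T0 has_field_derivative_def has_derivative_subset by blast
    from has_derivative_in_compose[OF TS this] show ?thesis
      using at_within_open[OF S(2,1)] by simp
  qed
  have fd: "frechet_derivative (F v w) (at z) x
     = l' * T' z x * symplectic v w
       + m' * T' z x * (T' z v * (snd z \<bullet> fst w) - T' z w * (snd z \<bullet> fst v))
       + mu (T z) * (D v x * (snd z \<bullet> fst w) + T' z v * (snd x \<bullet> fst w)
           - D w x * (snd z \<bullet> fst v) - T' z w * (snd x \<bullet> fst v))" for v w x
  proof -
    let ?G = "\<lambda>y. lam (T y) * symplectic v w
      + mu (T y) * (T' y v * (snd y \<bullet> fst w) - T' y w * (snd y \<bullet> fst v))"
    have in': "((\<lambda>y. snd y \<bullet> fst u) has_derivative (\<lambda>x. snd x \<bullet> fst u)) (at z)" for u :: "(real^'n) \<times> (real^'n)"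
      by (auto intro!: derivative_eq_intros)
    have "(?G has_derivative (\<lambda>x. l' * T' z x * symplectic v w
       + m' * T' z x * (T' z v * (snd z \<bullet> fst w) - T' z w * (snd z \<bullet> fst v))
       + mu (T z) * (D v x * (snd z \<bullet> fst w) + T' z v * (snd x \<bullet> fst w)
           - D w x * (snd z \<bullet> fst v) - T' z w * (snd x \<bullet> fst v)))) (at z)"
      by (rule has_derivative_eq_rhs, (rule comp[OF lam] comp[OF mu] D in' has_derivative_const
          has_derivative_add has_derivative_diff has_derivative_mult)+) (simp add: fun_eq_iff algebra_simps)
    then have "(F v w has_derivative (\<lambda>x. l' * T' z x * symplectic v w
       + m' * T' z x * (T' z v * (snd z \<bullet> fst w) - T' z w * (snd z \<bullet> fst v))
       + mu (T z) * (D v x * (snd z \<bullet> fst w) + T' z v * (snd x \<bullet> fst w)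
           - D w x * (snd z \<bullet> fst v) - T' z w * (snd x \<bullet> fst v)))) (at z)"
      by (rule has_derivative_transform_within_open[OF _ S]) (simp add: F)
    from fun_cong[OF frechet_derivative_at[OF this], of x] show ?thesis by simp
  qed
  show ?thesis unfolding fd sym[of b a] sym[of e a] sym[of e b] symplectic_def
    by (simp add: algebra_simps inner_commute)
qed

section \<open>Algebra of smooth functions\<close>

lemma frechet_derivative_cong_on:
  assumes "\<And>y. y \<in> S \<Longrightarrow> f y = g y" "x \<in> S"
  shows "f differentiable (at x within S) \<longleftrightarrow> g differentiable (at x within S)"
    and "frechet_derivative f (at x within S) = frechet_derivative g (at x within S)"
proof -
  have "(f has_derivative D) (at x within S) \<longleftrightarrow> (g has_derivative D) (at x within S)" for D
    using has_derivative_transform[OF assms(2), of g f D] has_derivative_transform[OF assms(2), of f g D] assms(1)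
    by auto
  then show "f differentiable (at x within S) \<longleftrightarrow> g differentiable (at x within S)"
    and "frechet_derivative f (at x within S) = frechet_derivative g (at x within S)"
    unfolding differentiable_def frechet_derivative_def by auto
qed

text \<open>
  The recursion for \<open>Ck_on\<close> mentions the derivative only at points of \<open>S\<close>, so explicit formulas
  that hold on \<open>S\<close> can be used in its place.
\<close>

lemma Ck_on_cong:
  assumes "\<And>y. y \<in> S \<Longrightarrow> f y = g y"
  shows "Ck_on k S f \<longleftrightarrow> Ck_on k S g"
  using assms
proof (induction k arbitrary: f g)
  case 0
  show ?case unfolding Ck_on.simps(1) by (rule continuous_on_cong[OF refl 0])
next
  case (Suc k)
  note eq = frechet_derivative_cong_on[of S f g, OF Suc.prems]
  have "Ck_on k S (\<lambda>x. frechet_derivative f (at x within S) v)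
      \<longleftrightarrow> Ck_on k S (\<lambda>x. frechet_derivative g (at x within S) v)" for v
    by (rule Suc.IH) (simp only: eq(2))
  then show ?case unfolding Ck_on.simps(2) using eq(1) by blast
qed

lemma Ck_on_SucD:
  assumes "Ck_on (Suc k) S f"
  shows "Ck_on k S f"
  using assms
proof (induction k arbitrary: f)
  case 0
  then have "f differentiable_on S" by (simp add: differentiable_on_def)
  then show ?case by (simp add: differentiable_imp_continuous_on)
next
  case (Suc k)
  then show ?case unfolding Ck_on.simps(2)[of "Suc k"] Ck_on.simps(2)[of k S f] by blast
qed

text \<open>
  On an open set any family of derivatives is the Frechet derivative, which reduces the closure
  properties below to the rules for derivatives and an induction.
\<close>

lemma Ck_on_Suc_openI:
  assumes "open S"
    and f: "\<And>x. x \<in> S \<Longrightarrow> (f has_derivative D x) (at x)"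
    and D: "\<And>v. Ck_on k S (\<lambda>x. D x v)"
  shows "Ck_on (Suc k) S f"
proof -
  have f': "(f has_derivative D x) (at x within S)" if "x \<in> S" for x
    by (rule has_derivative_at_withinI[OF f[OF that]])
  have eq: "D x = frechet_derivative f (at x within S)" if "x \<in> S" for x
    unfolding at_within_open[OF that assms(1)] by (rule frechet_derivative_at[OF f[OF that]])
  have "Ck_on k S (\<lambda>x. D x v) \<longleftrightarrow> Ck_on k S (\<lambda>x. frechet_derivative f (at x within S) v)" for v
    by (rule Ck_on_cong) (simp only: eq)
  then have "Ck_on k S (\<lambda>x. frechet_derivative f (at x within S) v)" for v
    using D[of v] by blast
  moreover have "f differentiable (at x within S)" if "x \<in> S" for x
    using f'[OF that] by (rule differentiableI)
  ultimately show ?thesis unfolding Ck_on.simps(2) by blast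
qed

lemma Ck_on_Suc_has_derivative:
  assumes "Ck_on (Suc k) S f" "open S" "x \<in> S"
  shows "(f has_derivative frechet_derivative f (at x within S)) (at x)"
proof -
  have "f differentiable (at x within S)" using assms(1,3) unfolding Ck_on.simps(2) by blast
  then show ?thesis unfolding frechet_derivative_works at_within_open[OF assms(3,2)] .
qed

lemma Ck_on_subset:
  assumes "Ck_on k S f" "open S" "open W" "W \<subseteq> S"
  shows "Ck_on k W f"
  using assms(1)
proof (induction k arbitrary: f)
  case 0
  then show ?case using assms(4) continuous_on_subset by auto
next
  case (Suc k)
  show ?case
  proof (rule Ck_on_Suc_openI[OF assms(3)])
    show "(f has_derivative frechet_derivative f (at x within S)) (at x)" if "x \<in> W" for x
      using Ck_on_Suc_has_derivative[OF Suc.prems assms(2)] assms(4) that by blast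
    show "Ck_on k W (\<lambda>x. frechet_derivative f (at x within S) v)" for v
      using Suc by simp
  qed
qed

lemma Ck_on_const: "open S \<Longrightarrow> Ck_on k S (\<lambda>x. c)"
proof (induction k arbitrary: c)
  case (Suc k)
  show ?case by (rule Ck_on_Suc_openI[OF Suc.prems has_derivative_const Suc.IH[OF Suc.prems]])
qed simp

lemma Ck_on_bounded_linear:
  assumes "Ck_on k S f" "open S" "bounded_linear L"
  shows "Ck_on k S (\<lambda>x. L (f x))"
  using assms(1)
proof (induction k arbitrary: f)
  case 0
  then show ?case using bounded_linear.continuous_on[OF assms(3)] by auto
next
  case (Suc k)
  show ?case
  proof (rule Ck_on_Suc_openI[OF assms(2)])
    show "((\<lambda>x. L (f x)) has_derivative (\<lambda>v. L (frechet_derivative f (at x within S) v))) (at x)" if "x \<in> S" for x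
      by (intro bounded_linear.has_derivative[OF assms(3)] Ck_on_Suc_has_derivative[OF Suc.prems assms(2) that])
    show "Ck_on k S (\<lambda>x. L (frechet_derivative f (at x within S) v))" for v
      using Suc by simp
  qed
qed

lemma Ck_on_add:
  assumes "Ck_on k S f" "Ck_on k S g" "open S"
  shows "Ck_on k S (\<lambda>x. f x + g x)"
  using assms(1,2)
proof (induction k arbitrary: f g)
  case 0
  then show ?case by (auto intro: continuous_on_add)
next
  case (Suc k)
  show ?case
  proof (rule Ck_on_Suc_openI[OF assms(3)])
    show "((\<lambda>x. f x + g x) has_derivative (\<lambda>v. frechet_derivative f (at x within S) v
        + frechet_derivative g (at x within S) v)) (at x)" if "x \<in> S" for x
      by (rule has_derivative_add[OF Ck_on_Suc_has_derivative[OF Suc.prems(1) assms(3) that]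
            Ck_on_Suc_has_derivative[OF Suc.prems(2) assms(3) that]])
    show "Ck_on k S (\<lambda>x. frechet_derivative f (at x within S) v + frechet_derivative g (at x within S) v)" for v
      using Suc by simp
  qed
qed

lemma Ck_on_mult:
  fixes f g :: "'a::euclidean_space \<Rightarrow> real"
  assumes "Ck_on k S f" "Ck_on k S g" "open S"
  shows "Ck_on k S (\<lambda>x. f x * g x)"
  using assms(1,2)
proof (induction k arbitrary: f g)
  case 0
  then show ?case by (auto intro: continuous_on_mult)
next
  case (Suc k)
  show ?case
  proof (rule Ck_on_Suc_openI[OF assms(3)])
    show "((\<lambda>x. f x * g x) has_derivative (\<lambda>v. f x * frechet_derivative g (at x within S) v
        + frechet_derivative f (at x within S) v * g x)) (at x)" if "x \<in> S" for x
      by (rule has_derivative_mult[OF Ck_on_Suc_has_derivative[OF Suc.prems(1) assms(3) that]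
            Ck_on_Suc_has_derivative[OF Suc.prems(2) assms(3) that]])
    show "Ck_on k S (\<lambda>x. f x * frechet_derivative g (at x within S) v
        + frechet_derivative f (at x within S) v * g x)" for v
    proof -
      have "Ck_on k S (\<lambda>x. frechet_derivative f (at x within S) v)"
        "Ck_on k S (\<lambda>x. frechet_derivative g (at x within S) v)"
        using Suc.prems by simp_all
      with Suc.prems[THEN Ck_on_SucD] show ?thesis by (intro Ck_on_add Suc.IH assms(3))
    qed
  qed
qed

lemma smooth_on_lincomb:
  fixes f g :: "'a::euclidean_space \<Rightarrow> real"
  assumes "smooth_on S f" "smooth_on S g" "open S"
  shows "smooth_on S (\<lambda>x. a * f x + b * g x)"
  unfolding smooth_on_def
proof
  fix k
  have "Ck_on k S f" "Ck_on k S g" using assms(1,2) unfolding smooth_on_def by blast+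
  then show "Ck_on k S (\<lambda>x. a * f x + b * g x)"
    by (intro Ck_on_add[OF _ _ assms(3)] Ck_on_mult[OF _ _ assms(3)] Ck_on_const[OF assms(3)])
qed

lemma smooth_on_mult:
  fixes f g :: "'a::euclidean_space \<Rightarrow> real"
  assumes "smooth_on S f" "smooth_on S g" "open S"
  shows "smooth_on S (\<lambda>x. f x * g x)"
  using assms unfolding smooth_on_def by (metis Ck_on_mult)

lemma smooth_on_subset:
  assumes "smooth_on S f" "open S" "open W" "W \<subseteq> S"
  shows "smooth_on W f"
  unfolding smooth_on_def
  by (intro allI Ck_on_subset[OF _ assms(2-4)] assms(1)[unfolded smooth_on_def, rule_format])

lemma smooth_on_has_derivative:
  assumes "smooth_on S f" "open S" "x \<in> S"
  shows "(f has_derivative frechet_derivative f (at x)) (at x)"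
  using Ck_on_Suc_has_derivative[OF assms(1)[unfolded smooth_on_def, rule_format] assms(2,3)]
  unfolding at_within_open[OF assms(3,2)] .

lemma smooth_on_frechet_derivative:
  assumes "smooth_on S f" "open S"
  shows "smooth_on S (\<lambda>x. frechet_derivative f (at x) v)"
  unfolding smooth_on_def
proof
  fix k
  have "Ck_on k S (\<lambda>x. frechet_derivative f (at x within S) v)"
    using assms(1)[unfolded smooth_on_def, rule_format, of "Suc k"] by simp
  moreover have "Ck_on k S (\<lambda>x. frechet_derivative f (at x within S) v)
      \<longleftrightarrow> Ck_on k S (\<lambda>x. frechet_derivative f (at x) v)"
    by (rule Ck_on_cong) (simp only: at_within_open[OF _ assms(2)])
  ultimately show "Ck_on k S (\<lambda>x. frechet_derivative f (at x) v)" by blast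
qed

section \<open>Tangent vectors and coordinate vectors\<close>

lemma smooth_at_binary:
  fixes \<A> :: "('m, 'e::euclidean_space) chart set"
  assumes f: "smooth_at \<A> x f" and h: "smooth_at \<A> x h"
    and *: "\<And>(W :: 'e set) f h. smooth_on W f \<Longrightarrow> smooth_on W h \<Longrightarrow> open W \<Longrightarrow> smooth_on W (\<lambda>y. F (f y) (h y))"
  shows "smooth_at \<A> x (\<lambda>y. F (f y) (h y))"
  unfolding smooth_at_def
proof (intro ballI impI)
  fix \<kappa> assume \<kappa>: "\<kappa> \<in> \<A>" "x \<in> chart_dom \<kappa>"
  obtain W1 W2 where W: "open W1" "chart_map \<kappa> x \<in> W1" "W1 \<subseteq> chart_img \<kappa>" "smooth_on W1 (f \<circ> chart_inv \<kappa>)"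
      "open W2" "chart_map \<kappa> x \<in> W2" "smooth_on W2 (h \<circ> chart_inv \<kappa>)"
    using f h \<kappa> unfolding smooth_at_def by meson
  have "smooth_on (W1 \<inter> W2) (\<lambda>y. F ((f \<circ> chart_inv \<kappa>) y) ((h \<circ> chart_inv \<kappa>) y))"
    by (rule *[OF smooth_on_subset[OF W(4,1)] smooth_on_subset[OF W(7,5)]]) (use W in auto)
  then show "\<exists>W. open W \<and> chart_map \<kappa> x \<in> W \<and> W \<subseteq> chart_img \<kappa> \<and>
      smooth_on W ((\<lambda>y. F (f y) (h y)) \<circ> chart_inv \<kappa>)"
    using W by (intro exI[of _ "W1 \<inter> W2"]) (auto simp: o_def)
qed

lemma smooth_at_lincomb:
  "smooth_at \<A> x f \<Longrightarrow> smooth_at \<A> x h \<Longrightarrow> smooth_at \<A> x (\<lambda>y. a * f y + b * h y)"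
  by (rule smooth_at_binary[where F = "\<lambda>r s. a * r + b * s"]) (assumption | rule smooth_on_lincomb)+

lemma smooth_at_mult:
  "smooth_at \<A> x f \<Longrightarrow> smooth_at \<A> x h \<Longrightarrow> smooth_at \<A> x (\<lambda>y. f y * h y)"
  by (rule smooth_at_binary[where F = "(*)"]) (assumption | rule smooth_on_mult)+

lemma smooth_at_has_derivative:
  assumes "smooth_at \<A> x f" "\<kappa> \<in> \<A>" "x \<in> chart_dom \<kappa>"
  shows "((f \<circ> chart_inv \<kappa>) has_derivative chart_deriv \<kappa> f x) (at (chart_map \<kappa> x))"
proof -
  obtain W where "open W" "chart_map \<kappa> x \<in> W" "smooth_on W (f \<circ> chart_inv \<kappa>)"
    using assms unfolding smooth_at_def by meson
  then show ?thesis using smooth_on_has_derivative unfolding chart_deriv_def by blast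
qed

lemma coord_vec_lincomb:
  assumes "\<kappa> \<in> \<A>" "x \<in> chart_dom \<kappa>"
  shows "coord_vec \<A> \<kappa> x (a *\<^sub>R e + b *\<^sub>R e') f = a * coord_vec \<A> \<kappa> x e f + b * coord_vec \<A> \<kappa> x e' f"
  using has_derivative_linear[OF smooth_at_has_derivative[of \<A> x f \<kappa>]] assms
  by (auto simp: coord_vec_def linear_add linear_scale)

lemma linear_coord_vec:
  assumes "\<kappa> \<in> \<A>" "x \<in> chart_dom \<kappa>"
  shows "linear (\<lambda>e. coord_vec \<A> \<kappa> x e f)"
  using coord_vec_lincomb[OF assms, of 1 _ 1] coord_vec_lincomb[OF assms, of _ _ 0] by (intro linearI) auto

text \<open>
  The Leibniz rule for a coordinate vector evaluates the factors at \<open>chart_inv \<kappa> (chart_map \<kappa> x)\<close>.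
  Hence the assumption that this point is \<open>x\<close>; stated pointwise, it applies to cotangent charts
  without a proof that these are injective.
\<close>

lemma coord_vec_in_tangent_space:
  assumes \<kappa>: "\<kappa> \<in> \<A>" "x \<in> chart_dom \<kappa>" and inv: "chart_inv \<kappa> (chart_map \<kappa> x) = x"
  shows "coord_vec \<A> \<kappa> x e \<in> tangent_space \<A> x"
  unfolding tangent_space_def mem_Collect_eq
proof (intro conjI allI impI)
  fix f h a b
  assume f: "smooth_at \<A> x f" and h: "smooth_at \<A> x h"
  note df = smooth_at_has_derivative[OF f \<kappa>] and dh = smooth_at_has_derivative[OF h \<kappa>]
  have "chart_deriv \<kappa> (\<lambda>y. a * f y + b * h y) x = (\<lambda>e. a * chart_deriv \<kappa> f x e + b * chart_deriv \<kappa> h x e)"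
    unfolding chart_deriv_def[of \<kappa> "\<lambda>y. a * f y + b * h y"]
    using df dh by (intro frechet_derivative_at[symmetric]) (auto simp: o_def intro!: derivative_eq_intros)
  then show "coord_vec \<A> \<kappa> x e (\<lambda>y. a * f y + b * h y) = a * coord_vec \<A> \<kappa> x e f + b * coord_vec \<A> \<kappa> x e h"
    using f h by (simp add: coord_vec_def smooth_at_lincomb)
  have "chart_deriv \<kappa> (\<lambda>y. f y * h y) x = (\<lambda>e. f x * chart_deriv \<kappa> h x e + chart_deriv \<kappa> f x e * h x)"
    unfolding chart_deriv_def[of \<kappa> "\<lambda>y. f y * h y"]
    using has_derivative_mult[OF df dh] inv by (intro frechet_derivative_at[symmetric]) (simp add: o_def)
  then show "coord_vec \<A> \<kappa> x e (\<lambda>y. f y * h y) = f x * coord_vec \<A> \<kappa> x e h + h x * coord_vec \<A> \<kappa> x e f"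
    using f h by (simp add: coord_vec_def smooth_at_mult)
qed (simp add: coord_vec_def)

lemma tangent_spaceD:
  assumes "v \<in> tangent_space \<A> x"
  shows "\<not> smooth_at \<A> x f \<Longrightarrow> v f = 0"
    and "smooth_at \<A> x f \<Longrightarrow> smooth_at \<A> x h \<Longrightarrow> v (\<lambda>y. a * f y + b * h y) = a * v f + b * v h"
    and "smooth_at \<A> x f \<Longrightarrow> smooth_at \<A> x h \<Longrightarrow> v (\<lambda>y. f y * h y) = f x * v h + h x * v f"
proof -
  note v = assms[unfolded tangent_space_def mem_Collect_eq]
  show "\<not> smooth_at \<A> x f \<Longrightarrow> v f = 0"
    by (rule v[THEN conjunct1, rule_format])
  show "smooth_at \<A> x f \<Longrightarrow> smooth_at \<A> x h \<Longrightarrow> v (\<lambda>y. a * f y + b * h y) = a * v f + b * v h"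
    by (rule v[THEN conjunct2, THEN conjunct1, rule_format])
  show "smooth_at \<A> x f \<Longrightarrow> smooth_at \<A> x h \<Longrightarrow> v (\<lambda>y. f y * h y) = f x * v h + h x * v f"
    by (rule v[THEN conjunct2, THEN conjunct2, rule_format])
qed

lemma tangent_space_combine:
  assumes "v \<in> tangent_space \<A> x" "w \<in> tangent_space \<A> x"
  shows "(\<lambda>f. a * v f + b * w f) \<in> tangent_space \<A> x"
  unfolding tangent_space_def mem_Collect_eq
proof (intro conjI allI impI)
  show "a * v f + b * w f = 0" if "\<not> smooth_at \<A> x f" for f
    using assms[THEN tangent_spaceD(1), OF that] by simp
  fix f h c d
  assume fh: "smooth_at \<A> x f" "smooth_at \<A> x h"
  note * = assms[THEN tangent_spaceD(2), OF fh] assms[THEN tangent_spaceD(3), OF fh]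
  show "a * v (\<lambda>y. c * f y + d * h y) + b * w (\<lambda>y. c * f y + d * h y)
      = c * (a * v f + b * w f) + d * (a * v h + b * w h)"
    unfolding * by (simp add: algebra_simps)
  show "a * v (\<lambda>y. f y * h y) + b * w (\<lambda>y. f y * h y)
      = f x * (a * v h + b * w h) + h x * (a * v f + b * w f)"
    unfolding * by (simp add: algebra_simps)
qed

lemma tangent_space_sum:
  assumes "finite I" "\<And>i. i \<in> I \<Longrightarrow> W i \<in> tangent_space \<A> x"
  shows "(\<lambda>f. \<Sum>i\<in>I. a i * W i f) \<in> tangent_space \<A> x"
  using assms
proof (induction I rule: finite_induct)
  case empty
  then show ?case by (simp add: tangent_space_def)
next
  case (insert i I)
  then show ?case using tangent_space_combine[of "W i" \<A> x "\<lambda>f. \<Sum>i\<in>I. a i * W i f" "a i" 1] by simp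
qed

lemma lincomb_in_tangent_space:
  "(\<And>i. W i \<in> tangent_space \<A> x) \<Longrightarrow> lincomb a W \<in> tangent_space \<A> x"
  unfolding lincomb_def by (rule tangent_space_sum[OF finite])

lemma linear_form_on_sum:
  assumes \<alpha>: "linear_form_on (tangent_space \<A> x) \<alpha>"
    and I: "finite I" "\<And>i. i \<in> I \<Longrightarrow> W i \<in> tangent_space \<A> x"
  shows "\<alpha> (\<lambda>f. \<Sum>i\<in>I. a i * W i f) = (\<Sum>i\<in>I. a i * \<alpha> (W i))"
  using I
proof (induction I rule: finite_induct)
  case empty
  have "(\<lambda>f. 0) \<in> tangent_space \<A> x" by (simp add: tangent_space_def)
  from \<alpha>[unfolded linear_form_on_def, rule_format, OF this this, of 0 0]
  show ?case unfolding sum.empty by (simp only: mult_zero_left add_0_left)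
next
  case (insert i I)
  have "\<alpha> (\<lambda>f. a i * W i f + 1 * (\<Sum>i\<in>I. a i * W i f)) = a i * \<alpha> (W i) + 1 * \<alpha> (\<lambda>f. \<Sum>i\<in>I. a i * W i f)"
    by (rule \<alpha>[unfolded linear_form_on_def, rule_format])
      (blast intro: insert.prems tangent_space_sum[OF insert.hyps(1)])+
  also have "\<alpha> (\<lambda>f. \<Sum>i\<in>I. a i * W i f) = (\<Sum>i\<in>I. a i * \<alpha> (W i))"
    by (rule insert.IH[OF insert.prems[OF insertI2]])
  finally show ?case unfolding sum.insert[OF insert.hyps] mult_1_left .
qed

lemma linear_form_on_lincomb:
  assumes "linear_form_on (tangent_space \<A> x) \<alpha>" "\<And>i. W i \<in> tangent_space \<A> x"
  shows "\<alpha> (lincomb a W) = (\<Sum>i\<in>UNIV. a i * \<alpha> (W i))"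
  unfolding lincomb_def by (rule linear_form_on_sum[OF assms(1) finite assms(2)])

lemma chart_inv_works:
  assumes "q \<in> chart_img \<kappa>"
  shows "chart_inv \<kappa> q \<in> chart_dom \<kappa>" "chart_map \<kappa> (chart_inv \<kappa> q) = q"
  using assms unfolding chart_inv_def chart_img_def by (auto intro: inv_into_into f_inv_into_f)

lemma smooth_manifoldD:
  assumes "smooth_manifold X \<A>"
  shows "topspace X \<noteq> {}" "carrier_of \<A> = topspace X"
    and "\<kappa> \<in> \<A> \<Longrightarrow> openin X (chart_dom \<kappa>)" "\<kappa> \<in> \<A> \<Longrightarrow> open (chart_img \<kappa>)"
    and "\<kappa> \<in> \<A> \<Longrightarrow> homeomorphic_map (subtopology X (chart_dom \<kappa>)) (top_of_set (chart_img \<kappa>)) (chart_map \<kappa>)"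
    and "\<kappa> \<in> \<A> \<Longrightarrow> \<kappa>' \<in> \<A> \<Longrightarrow>
        smooth_on (chart_map \<kappa> ` (chart_dom \<kappa> \<inter> chart_dom \<kappa>')) (chart_map \<kappa>' \<circ> chart_inv \<kappa>)"
  using assms unfolding smooth_manifold_def by blast+

lemma chart_inv_chart_map:
  assumes X: "smooth_manifold X \<A>" and \<kappa>: "\<kappa> \<in> \<A>" "x \<in> chart_dom \<kappa>"
  shows "chart_inv \<kappa> (chart_map \<kappa> x) = x"
proof -
  have "chart_dom \<kappa> \<subseteq> topspace X" using smooth_manifoldD(3)[OF X \<kappa>(1)] openin_subset by blast
  then have "inj_on (chart_map \<kappa>) (chart_dom \<kappa>)"
    using homeomorphic_imp_injective_map[OF smooth_manifoldD(5)[OF X \<kappa>(1)]]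
    by (simp add: Int_absorb1)
  then show ?thesis using \<kappa>(2) unfolding chart_inv_def by simp
qed

text \<open>
  In any other chart the coordinate function is a component of a transition map. It serves as a test
  function that separates coordinate vectors.
\<close>

lemma smooth_at_coordinate:
  fixes \<A> :: "('m, real^'n) chart set"
  assumes X: "smooth_manifold X \<A>" and \<kappa>: "\<kappa> \<in> \<A>" "x \<in> chart_dom \<kappa>"
  shows "smooth_at \<A> x (\<lambda>y. chart_map \<kappa> y $ i)"
  unfolding smooth_at_def
proof (intro ballI impI exI conjI)
  fix \<kappa>' assume \<kappa>': "\<kappa>' \<in> \<A>" "x \<in> chart_dom \<kappa>'"
  let ?W = "chart_map \<kappa>' ` (chart_dom \<kappa>' \<inter> chart_dom \<kappa>)"
  have "openin (subtopology X (chart_dom \<kappa>')) (chart_dom \<kappa>' \<inter> chart_dom \<kappa>)"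
    using smooth_manifoldD(3)[OF X \<kappa>(1)] openin_subtopology_Int2 by blast
  then have "openin (top_of_set (chart_img \<kappa>')) ?W"
    using homeomorphic_imp_open_map[OF smooth_manifoldD(5)[OF X \<kappa>'(1)]] unfolding open_map_def by blast
  then show W: "open ?W"
    using smooth_manifoldD(4)[OF X \<kappa>'(1)] openin_open_eq by blast
  show "chart_map \<kappa>' x \<in> ?W" "?W \<subseteq> chart_img \<kappa>'"
    using \<kappa>(2) \<kappa>'(2) by (auto simp: chart_img_def)
  have "smooth_on ?W (chart_map \<kappa> \<circ> chart_inv \<kappa>')"
    by (rule smooth_manifoldD(6)[OF X \<kappa>'(1) \<kappa>(1)])
  then show "smooth_on ?W ((\<lambda>y. chart_map \<kappa> y $ i) \<circ> chart_inv \<kappa>')"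
    using Ck_on_bounded_linear[OF _ W bounded_linear_vec_nth[of i], of _ "chart_map \<kappa> \<circ> chart_inv \<kappa>'"]
    unfolding smooth_on_def o_def by blast
qed

lemma coord_vec_coordinate:
  fixes \<A> :: "('m, real^'n) chart set"
  assumes X: "smooth_manifold X \<A>" and \<kappa>: "\<kappa> \<in> \<A>" "x \<in> chart_dom \<kappa>"
  shows "coord_vec \<A> \<kappa> x e (\<lambda>y. chart_map \<kappa> y $ i) = e $ i"
proof -
  have x: "chart_map \<kappa> x \<in> chart_img \<kappa>" using \<kappa>(2) by (simp add: chart_img_def)
  have "((\<lambda>q. q $ i) has_derivative (\<lambda>e. e $ i)) (at (chart_map \<kappa> x))"
    by (rule bounded_linear_imp_has_derivative[OF bounded_linear_vec_nth])
  then have "((\<lambda>y. chart_map \<kappa> y $ i) \<circ> chart_inv \<kappa> has_derivative (\<lambda>e. e $ i)) (at (chart_map \<kappa> x))"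
    by (rule has_derivative_transform_within_open[OF _ smooth_manifoldD(4)[OF X \<kappa>(1)] x])
      (simp add: chart_inv_works)
  from frechet_derivative_at[OF this, symmetric] show ?thesis
    using smooth_at_coordinate[OF X \<kappa>] by (simp add: coord_vec_def chart_deriv_def)
qed

lemma coord_vec_axis_sum:
  fixes \<A> :: "('m, real^'n) chart set"
  assumes \<kappa>: "\<kappa> \<in> \<A>" "x \<in> chart_dom \<kappa>"
  shows "coord_vec \<A> \<kappa> x e = lincomb (\<lambda>i. e $ i) (\<lambda>i. coord_vec \<A> \<kappa> x (axis i 1))"
proof
  fix f
  interpret linear "\<lambda>e. coord_vec \<A> \<kappa> x e f" by (rule linear_coord_vec[OF \<kappa>])
  show "coord_vec \<A> \<kappa> x e f = lincomb (\<lambda>i. e $ i) (\<lambda>i. coord_vec \<A> \<kappa> x (axis i 1)) f"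
    by (subst basis_expansion[of e, symmetric]) (simp add: sum scale lincomb_def scalar_mult_eq_scaleR)
qed

section \<open>A Riemannian metric in coordinates\<close>

lemma riemannian_metricD:
  assumes "riemannian_metric \<A> g"
  shows "x \<in> carrier_of \<A> \<Longrightarrow> v \<in> tangent_space \<A> x \<Longrightarrow> linear_form_on (tangent_space \<A> x) (g x v)"
    and "x \<in> carrier_of \<A> \<Longrightarrow> v \<in> tangent_space \<A> x \<Longrightarrow> w \<in> tangent_space \<A> x \<Longrightarrow> g x v w = g x w v"
    and "x \<in> carrier_of \<A> \<Longrightarrow> v \<in> tangent_space \<A> x \<Longrightarrow> v \<noteq> (\<lambda>f. 0) \<Longrightarrow> g x v v > 0"
    and "\<kappa> \<in> \<A> \<Longrightarrow> smooth_on (chart_img \<kappa>)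
        ((\<lambda>x. g x (coord_vec \<A> \<kappa> x e) (coord_vec \<A> \<kappa> x e')) \<circ> chart_inv \<kappa>)"
  using assms unfolding riemannian_metric_def by blast+

lemma bilinear_lincomb:
  assumes g: "riemannian_metric \<A> g" and x: "x \<in> carrier_of \<A>"
    and V: "\<And>i. V i \<in> tangent_space \<A> x" and W: "\<And>i. W i \<in> tangent_space \<A> x"
  shows "g x (lincomb a V) (lincomb b W) = (\<Sum>i\<in>UNIV. \<Sum>j\<in>UNIV. a i * b j * g x (V i) (W j))"
proof -
  note aV = lincomb_in_tangent_space[of V \<A> x a, OF V]
  have "g x (lincomb a V) (W j) = (\<Sum>i\<in>UNIV. a i * g x (V i) (W j))" for j
  proof -
    have "g x (lincomb a V) (W j) = g x (W j) (lincomb a V)"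
      by (rule riemannian_metricD(2)[OF g x aV W])
    also have "\<dots> = (\<Sum>i\<in>UNIV. a i * g x (W j) (V i))"
      by (rule linear_form_on_lincomb[OF riemannian_metricD(1)[OF g x W] V])
    also have "\<dots> = (\<Sum>i\<in>UNIV. a i * g x (V i) (W j))"
      by (simp only: riemannian_metricD(2)[OF g x W V])
    finally show ?thesis .
  qed
  moreover have "g x (lincomb a V) (lincomb b W) = (\<Sum>j\<in>UNIV. b j * g x (lincomb a V) (W j))"
    by (rule linear_form_on_lincomb[OF riemannian_metricD(1)[OF g x aV] W])
  ultimately show ?thesis
    by (simp add: sum_distrib_left ac_simps) (rule sum.swap)
qed

lemma metric_mat_inner:
  fixes \<A> :: "('m, real^'n) chart set"
  assumes X: "smooth_manifold X \<A>" and g: "riemannian_metric \<A> g"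
    and \<kappa>: "\<kappa> \<in> \<A>" "x \<in> chart_dom \<kappa>"
  shows "a \<bullet> (metric_mat \<A> g \<kappa> x *v b) = g x (coord_vec \<A> \<kappa> x a) (coord_vec \<A> \<kappa> x b)"
proof -
  have T: "coord_vec \<A> \<kappa> x e \<in> tangent_space \<A> x" for e
    by (rule coord_vec_in_tangent_space[OF \<kappa> chart_inv_chart_map[OF X \<kappa>]])
  have x: "x \<in> carrier_of \<A>" using \<kappa> by (auto simp: carrier_of_def)
  show ?thesis
    unfolding coord_vec_axis_sum[OF \<kappa>, of a] coord_vec_axis_sum[OF \<kappa>, of b] bilinear_lincomb[OF g x T T]
    by (simp add: inner_vec_def matrix_vector_mult_def metric_mat_def sum_distrib_left ac_simps)
qed

text \<open>
  A nonzero coefficient vector gives a nonzero tangent vector, as the coordinate functions show.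
\<close>

lemma metric_mat_pos:
  fixes \<A> :: "('m, real^'n) chart set"
  assumes X: "smooth_manifold X \<A>" and g: "riemannian_metric \<A> g"
    and \<kappa>: "\<kappa> \<in> \<A>" "x \<in> chart_dom \<kappa>" and "a \<noteq> 0"
  shows "0 < a \<bullet> (metric_mat \<A> g \<kappa> x *v a)"
proof -
  have "coord_vec \<A> \<kappa> x a \<in> tangent_space \<A> x"
    by (rule coord_vec_in_tangent_space[OF \<kappa> chart_inv_chart_map[OF X \<kappa>]])
  moreover have "x \<in> carrier_of \<A>" using \<kappa> by (auto simp: carrier_of_def)
  moreover have "coord_vec \<A> \<kappa> x a \<noteq> (\<lambda>f. 0)"
    using coord_vec_coordinate[OF X \<kappa>, of a] \<open>a \<noteq> 0\<close> by (metis vec_eq_iff zero_index)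
  ultimately show ?thesis unfolding metric_mat_inner[OF X g \<kappa>] using riemannian_metricD(3)[OF g] by blast
qed

lemma metric_mat_invertible:
  fixes \<A> :: "('m, real^'n) chart set"
  assumes "smooth_manifold X \<A>" "riemannian_metric \<A> g" "\<kappa> \<in> \<A>" "x \<in> chart_dom \<kappa>"
  shows "invertible (metric_mat \<A> g \<kappa> x)"
  unfolding invertible_left_inverse matrix_left_invertible_ker
  using metric_mat_pos[OF assms] by (metis inner_zero_right less_irrefl)

lemma metric_mat_symmetric:
  fixes \<A> :: "('m, real^'n) chart set"
  assumes X: "smooth_manifold X \<A>" and g: "riemannian_metric \<A> g"
    and \<kappa>: "\<kappa> \<in> \<A>" "x \<in> chart_dom \<kappa>"
  shows "transpose (metric_mat \<A> g \<kappa> x) = metric_mat \<A> g \<kappa> x"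
proof -
  have "coord_vec \<A> \<kappa> x e \<in> tangent_space \<A> x" for e
    by (rule coord_vec_in_tangent_space[OF \<kappa> chart_inv_chart_map[OF X \<kappa>]])
  moreover have "x \<in> carrier_of \<A>" using \<kappa> by (auto simp: carrier_of_def)
  ultimately show ?thesis using riemannian_metricD(2)[OF g]
    by (simp add: transpose_def metric_mat_def vec_eq_iff)
qed

definition metric_coord :: "('m, real^'n) chart set \<Rightarrow> 'm bilin_field \<Rightarrow> ('m, real^'n) chart \<Rightarrow> real^'n \<Rightarrow> real^'n^'n" where
  "metric_coord \<A> g \<kappa> q = metric_mat \<A> g \<kappa> (chart_inv \<kappa> q)"

definition metric_deriv :: "('m, real^'n) chart set \<Rightarrow> 'm bilin_field \<Rightarrow> ('m, real^'n) chart \<Rightarrow> real^'n \<Rightarrow> real^'n \<Rightarrow> real^'n^'n" where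
  "metric_deriv \<A> g \<kappa> q v =
     (\<chi> i j. frechet_derivative (\<lambda>q. metric_coord \<A> g \<kappa> q $ i $ j) (at q) v)"

lemma smooth_on_metric_coord:
  assumes "riemannian_metric \<A> g" "\<kappa> \<in> \<A>"
  shows "smooth_on (chart_img \<kappa>) (\<lambda>q. metric_coord \<A> g \<kappa> q $ i $ j)"
  using riemannian_metricD(4)[OF assms, of "axis i 1" "axis j 1"]
  by (simp add: metric_coord_def metric_mat_def o_def)

lemma has_derivative_metric_coord:
  assumes "smooth_manifold X \<A>" "riemannian_metric \<A> g" "\<kappa> \<in> \<A>" "q \<in> chart_img \<kappa>"
  shows "(metric_coord \<A> g \<kappa> has_derivative metric_deriv \<A> g \<kappa> q) (at q)"
proof -
  let ?M = "metric_coord \<A> g \<kappa>"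
  have entry: "((\<lambda>q. ?M q $ i $ j) has_derivative frechet_derivative (\<lambda>q. ?M q $ i $ j) (at q)) (at q)" for i j
    by (rule smooth_on_has_derivative[OF smooth_on_metric_coord[OF assms(2,3)] smooth_manifoldD(4)[OF assms(1,3)] assms(4)])
  then have "?M differentiable (at q)"
    by (intro differentiable_matrixI) (rule differentiableI)
  then obtain D where D: "(?M has_derivative D) (at q)" unfolding differentiable_def by blast
  have D': "((\<lambda>q. ?M q $ i $ j) has_derivative (\<lambda>v. D v $ i $ j)) (at q)" for i j
    using bounded_linear.has_derivative[OF bounded_linear_vec_nth
      bounded_linear.has_derivative[OF bounded_linear_vec_nth D]] .
  then have "D = metric_deriv \<A> g \<kappa> q"
    by (simp add: fun_eq_iff vec_eq_iff metric_deriv_def has_derivative_unique[OF entry D'])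
  then show ?thesis using D by simp
qed

lemma metric_deriv_differentiable:
  assumes "smooth_manifold X \<A>" "riemannian_metric \<A> g" "\<kappa> \<in> \<A>" "q \<in> chart_img \<kappa>"
  shows "(\<lambda>q. metric_deriv \<A> g \<kappa> q v) differentiable (at q)"
proof (rule differentiable_matrixI)
  note U = smooth_manifoldD(4)[OF assms(1,3)]
  show "(\<lambda>q. metric_deriv \<A> g \<kappa> q v $ i $ j) differentiable (at q)" for i j
    using smooth_on_has_derivative[OF smooth_on_frechet_derivative[OF smooth_on_metric_coord[OF assms(2,3)] U] U assms(4)]
    by (auto simp: metric_deriv_def intro: differentiableI)
qed

lemma metric_deriv_symmetric:
  assumes X: "smooth_manifold X \<A>" and g: "riemannian_metric \<A> g" and "\<kappa> \<in> \<A>" "q \<in> chart_img \<kappa>"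
  shows "metric_deriv \<A> g \<kappa> q v $ i $ j = metric_deriv \<A> g \<kappa> q v $ j $ i"
proof -
  have "metric_coord \<A> g \<kappa> y $ i $ j = metric_coord \<A> g \<kappa> y $ j $ i" if "y \<in> chart_img \<kappa>" for y
    using arg_cong[OF metric_mat_symmetric[OF X g assms(3) chart_inv_works(1)[OF that]], of "\<lambda>A. A $ j $ i"]
    by (simp add: metric_coord_def transpose_def)
  from frechet_derivative_cong_on(2)[of "chart_img \<kappa>", OF this assms(4)] show ?thesis
    unfolding at_within_open[OF assms(4) smooth_manifoldD(4)[OF X assms(3)]]
    by (simp add: metric_deriv_def)
qed

section \<open>The adapted frame of the cotangent bundle\<close>

lemma sum_UNIV_Plus:
  fixes f :: "'a::finite + 'b::finite \<Rightarrow> 'c::comm_monoid_add"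
  shows "(\<Sum>s\<in>UNIV. f s) = (\<Sum>i\<in>UNIV. f (Inl i)) + (\<Sum>j\<in>UNIV. f (Inr j))"
  using sum.Plus[of "UNIV :: 'a set" "UNIV :: 'b set" f] by (simp add: UNIV_Plus_UNIV)

text \<open>
  All blocks of \<open>G\<close> and \<open>J\<close> in the adapted frame have entries of the form \<open>c M\<^sub>i\<^sub>j + d r\<^sub>i r\<^sub>j\<close>. This lemma
  and the next replace their index sums by inner products and matrix products.
\<close>

lemma sum_scaled_rank_one_update:
  fixes M :: "real^'n^'n"
  shows "(\<Sum>i\<in>UNIV. \<Sum>k\<in>UNIV. x $ i * y $ k * (c * M $ i $ k + d * r $ i * r $ k))
    = c * (x \<bullet> (M *v y)) + d * (x \<bullet> r) * (y \<bullet> r)"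
proof -
  have "(\<Sum>i\<in>UNIV. \<Sum>k\<in>UNIV. x $ i * y $ k * (c * M $ i $ k + d * r $ i * r $ k))
    = (\<Sum>i\<in>UNIV. \<Sum>k\<in>UNIV. c * (x $ i * (M $ i $ k * y $ k)) + d * ((x $ i * r $ i) * (y $ k * r $ k)))"
    by (intro sum.cong refl) (simp add: algebra_simps)
  also have "\<dots> = c * (\<Sum>i\<in>UNIV. x $ i * (\<Sum>k\<in>UNIV. M $ i $ k * y $ k))
      + d * ((\<Sum>i\<in>UNIV. x $ i * r $ i) * (\<Sum>k\<in>UNIV. y $ k * r $ k))"
    unfolding sum_product by (simp only: sum.distrib sum_distrib_left)
  finally show ?thesis by (simp add: inner_vec_def matrix_vector_mult_def)
qed

lemma scaled_rank_one_update_mult: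
  fixes M :: "real^'n^'n"
  assumes "transpose M = M"
  shows "(\<chi> k. \<Sum>j\<in>UNIV. x $ j * (c * M $ j $ k + d * r $ j * r $ k)) = c *\<^sub>R (M *v x) + (d * (x \<bullet> r)) *\<^sub>R r"
proof (rule vec_eq_iff[THEN iffD2, rule_format])
  fix k
  have "(\<Sum>j\<in>UNIV. x $ j * (c * M $ j $ k + d * r $ j * r $ k))
      = (\<Sum>j\<in>UNIV. c * (transpose M $ k $ j * x $ j) + d * (x $ j * r $ j) * r $ k)"
    by (intro sum.cong refl) (simp add: transpose_def algebra_simps)
  also have "\<dots> = c * (\<Sum>j\<in>UNIV. M $ k $ j * x $ j) + d * (\<Sum>j\<in>UNIV. x $ j * r $ j) * r $ k"
    unfolding assms by (simp only: sum.distrib sum_distrib_left sum_distrib_right)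
  finally show "(\<chi> k. \<Sum>j\<in>UNIV. x $ j * (c * M $ j $ k + d * r $ j * r $ k)) $ k
      = (c *\<^sub>R (M *v x) + (d * (x \<bullet> r)) *\<^sub>R r) $ k"
    by (simp add: inner_vec_def matrix_vector_mult_def)
qed

locale riemannian_chart =
  fixes X :: "'m topology" and \<A> :: "('m, real^'n) chart set" and g :: "'m bilin_field"
    and \<kappa> :: "('m, real^'n) chart"
  assumes X: "smooth_manifold X \<A>" and g: "riemannian_metric \<A> g" and \<kappa>: "\<kappa> \<in> \<A>"
begin

abbreviation "U \<equiv> chart_img \<kappa>"
abbreviation "M \<equiv> metric_coord \<A> g \<kappa>"
abbreviation "M' \<equiv> metric_deriv \<A> g \<kappa>"
abbreviation "K \<equiv> cot_chart \<A> \<kappa>"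

lemma open_U: "open U"
  by (rule smooth_manifoldD(4)[OF X \<kappa>])

lemma M_invertible: "q \<in> U \<Longrightarrow> invertible (M q)"
  unfolding metric_coord_def by (rule metric_mat_invertible[OF X g \<kappa> chart_inv_works(1)])

lemma M_symmetric: "q \<in> U \<Longrightarrow> transpose (M q) = M q"
  unfolding metric_coord_def by (rule metric_mat_symmetric[OF X g \<kappa> chart_inv_works(1)])

lemma M_pos: "q \<in> U \<Longrightarrow> a \<noteq> 0 \<Longrightarrow> 0 < a \<bullet> (M q *v a)"
  unfolding metric_coord_def by (rule metric_mat_pos[OF X g \<kappa> chart_inv_works(1)])

lemmas M_deriv = has_derivative_metric_coord[OF X g \<kappa>]
lemmas M'_symmetric = metric_deriv_symmetric[OF X g \<kappa>]

lemma M_raise: "fst y \<in> U \<Longrightarrow> M (fst y) *v raise M y = snd y"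
  by (simp add: raise_def matrix_vector_mul_assoc matrix_inv_inverse M_invertible)

text \<open>
  Surjectivity onto all momenta: the covector at \<open>x\<close> with momentum \<open>p\<close> is \<open>v \<mapsto> p\<^sub>i v(x\<^sup>i)\<close>, where
  \<open>x\<^sup>i\<close> are the coordinate functions of the chart.
\<close>

lemma cot_chart_img: "chart_img K = U \<times> UNIV"
proof (intro subset_antisym subsetI)
  fix y :: "(real^'n) \<times> (real^'n)"
  assume "y \<in> U \<times> UNIV"
  then have q: "fst y \<in> U" by auto
  define x where "x = chart_inv \<kappa> (fst y)"
  have x: "x \<in> chart_dom \<kappa>" "chart_map \<kappa> x = fst y" using chart_inv_works[OF q] by (auto simp: x_def)
  define \<alpha> :: "'m covec" where "\<alpha> = (\<lambda>v. if v \<in> tangent_space \<A> x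
    then \<Sum>i\<in>UNIV. snd y $ i * v (\<lambda>y. chart_map \<kappa> y $ i) else 0)"
  have "linear_form_on (tangent_space \<A> x) \<alpha>"
    unfolding linear_form_on_def
    by (auto simp: \<alpha>_def tangent_space_combine sum_distrib_left sum.distrib algebra_simps)
  then have "(x, \<alpha>) \<in> chart_dom K"
    using x by (auto simp: cot_chart_def cotangent_space_def \<alpha>_def)
  moreover have "momentum \<A> \<kappa> (x, \<alpha>) = snd y"
    using coord_vec_in_tangent_space[OF \<kappa> x(1) chart_inv_chart_map[OF X \<kappa> x(1)]]
    by (simp add: momentum_def \<alpha>_def coord_vec_coordinate[OF X \<kappa> x(1)] vec_eq_iff axis_def if_distrib cong: if_cong)
  then have "chart_map K (x, \<alpha>) = y" using x by (simp add: cot_chart_def)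
  ultimately show "y \<in> chart_img K" unfolding chart_img_def by (metis imageI)
qed (auto simp: chart_img_def cot_chart_def)

text \<open>
  The matrix \<open>p\<^sub>k \<Gamma>\<^sup>k\<^sub>i\<^sub>h\<close> that occurs in the horizontal fields \<open>\<delta>/\<delta>q\<^sup>i\<close>.
\<close>

definition conn :: "(real^'n) \<times> (real^'n) \<Rightarrow> real^'n^'n" where
  "conn y = (\<chi> i h. \<Sum>k\<in>UNIV. snd y $ k * christoffel \<A> g \<kappa> k i h (chart_inv \<kappa> (fst y)))"

lemma conn_eq:
  assumes y: "fst y \<in> U"
  shows "conn y $ i $ h = (\<Sum>l\<in>UNIV. raise M y $ l * (M' (fst y) (axis i 1) $ l $ h
    + M' (fst y) (axis h 1) $ i $ l - M' (fst y) (axis l 1) $ i $ h)) / 2"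
proof -
  let ?N = "matrix_inv (M (fst y))"
  let ?X = "\<lambda>l. M' (fst y) (axis i 1) $ l $ h + M' (fst y) (axis h 1) $ i $ l - M' (fst y) (axis l 1) $ i $ h"
  have "christoffel \<A> g \<kappa> k i h (chart_inv \<kappa> (fst y)) = (\<Sum>l\<in>UNIV. ?N $ k $ l * ?X l) / 2" for k
    using chart_inv_works[OF y]
    by (simp add: christoffel_def chart_deriv_def metric_deriv_def metric_coord_def metric_inv_def o_def)
  then have "conn y $ i $ h = (\<Sum>k\<in>UNIV. \<Sum>l\<in>UNIV. ?N $ k $ l * snd y $ k * ?X l) / 2"
    by (simp add: conn_def sum_distrib_left sum_divide_distrib mult_ac)
  also have "(\<Sum>k\<in>UNIV. \<Sum>l\<in>UNIV. ?N $ k $ l * snd y $ k * ?X l)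
      = (\<Sum>l\<in>UNIV. (\<Sum>k\<in>UNIV. ?N $ k $ l * snd y $ k) * ?X l)"
    by (subst sum.swap) (simp add: sum_distrib_right)
  also have "\<dots> = (\<Sum>l\<in>UNIV. raise M y $ l * ?X l)"
  proof -
    have "?N $ k $ l = ?N $ l $ k" for k l
      using arg_cong[OF matrix_inv_symmetric[OF M_invertible M_symmetric, OF y y], of "\<lambda>A. A $ l $ k"]
      by (simp add: transpose_def)
    then show ?thesis by (simp add: raise_def matrix_vector_mult_def)
  qed
  finally show ?thesis .
qed

lemma conn_symmetric:
  assumes "fst y \<in> U"
  shows "conn y $ i $ h = conn y $ h $ i"
  unfolding conn_eq[OF assms]
  by (simp add: M'_symmetric[OF assms, of "axis i 1" _ h] M'_symmetric[OF assms, of "axis h 1" i]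
      M'_symmetric[OF assms, of _ i h] add.commute)

text \<open>
  Compatibility of the connection with the metric, contracted with \<open>g\<^sup>0\<^sup>h\<close>: the last two of the three
  derivatives of the metric in the Christoffel symbol cancel, being exchanged by swapping the two
  contracted indices.
\<close>

lemma raise_conn:
  assumes y: "fst y \<in> U"
  shows "raise M y \<bullet> (conn y *v v) = (raise M y \<bullet> (M' (fst y) v *v raise M y)) / 2"
proof -
  let ?u = "raise M y" and ?D = "\<lambda>i. M' (fst y) (axis i 1)"
  have axis: "(\<Sum>h\<in>UNIV. conn y $ i $ h * ?u $ h) = (?u \<bullet> (?D i *v ?u)) / 2" for i
  proof -
    have swap: "(\<Sum>h\<in>UNIV. \<Sum>l\<in>UNIV. ?u $ l * ?D h $ i $ l * ?u $ h)
        = (\<Sum>h\<in>UNIV. \<Sum>l\<in>UNIV. ?u $ l * ?D l $ i $ h * ?u $ h)"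
      by (subst sum.swap) (simp add: mult_ac)
    have "(\<Sum>h\<in>UNIV. conn y $ i $ h * ?u $ h) = (\<Sum>h\<in>UNIV. \<Sum>l\<in>UNIV. ?u $ l * ?D i $ l $ h * ?u $ h
        + (?u $ l * ?D h $ i $ l * ?u $ h - ?u $ l * ?D l $ i $ h * ?u $ h)) / 2"
      by (simp add: conn_eq[OF y] sum_distrib_left sum_distrib_right sum_divide_distrib algebra_simps)
    also have "\<dots> = (\<Sum>h\<in>UNIV. \<Sum>l\<in>UNIV. ?u $ l * ?D i $ l $ h * ?u $ h) / 2"
      unfolding sum.distrib sum_subtractf swap by simp
    also have "\<dots> = (?u \<bullet> (?D i *v ?u)) / 2"
      by (subst sum.swap) (simp add: inner_vec_def matrix_vector_mult_def sum_distrib_left mult_ac)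
    finally show ?thesis .
  qed
  interpret bounded_linear "\<lambda>v. ?u \<bullet> (M' (fst y) v *v ?u)"
    by (intro bounded_linear_inner_right_comp
        bounded_linear_compose[OF bounded_bilinear.bounded_linear_left[OF bounded_bilinear_matrix_vector_mult]]
        has_derivative_bounded_linear[OF M_deriv[OF y]])
  have "?u \<bullet> (conn y *v v) = (\<Sum>h\<in>UNIV. \<Sum>i\<in>UNIV. v $ i * (conn y $ i $ h * ?u $ h))"
    by (simp add: inner_vec_def matrix_vector_mult_def sum_distrib_left conn_symmetric[OF y, of _ _] mult_ac)
  also have "\<dots> = (\<Sum>i\<in>UNIV. v $ i * ((?u \<bullet> (?D i *v ?u)) / 2))"
    by (subst sum.swap) (simp add: axis[symmetric] sum_distrib_left)
  also have "\<dots> = (?u \<bullet> (M' (fst y) (\<Sum>i\<in>UNIV. v $ i *\<^sub>R axis i 1) *v ?u)) / 2"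
    by (simp add: sum scale sum_divide_distrib)
  also have "(\<Sum>i\<in>UNIV. v $ i *\<^sub>R axis i 1) = v"
    using basis_expansion[of v] by (simp add: scalar_mult_eq_scaleR)
  finally show ?thesis .
qed

text \<open>
  Choosing the covector with coordinates \<open>y\<close> through \<open>chart_inv\<close> ensures that \<open>chart_inv\<close> undoes the
  chart at this point, as coordinate vectors need it in order to be tangent vectors.
\<close>

definition cot_point :: "(real^'n) \<times> (real^'n) \<Rightarrow> 'm cot" where
  "cot_point y = chart_inv K y"

lemma cot_point:
  assumes "fst y \<in> U"
  shows "cot_point y \<in> chart_dom K" "chart_map K (cot_point y) = y" "chart_inv K (chart_map K (cot_point y)) = cot_point y"
    and "fst (cot_point y) = chart_inv \<kappa> (fst y)" "momentum \<A> \<kappa> (cot_point y) = snd y"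
proof -
  have "y \<in> chart_img K" using assms by (cases y) (simp add: cot_chart_img)
  from chart_inv_works[OF this] show *: "cot_point y \<in> chart_dom K" "chart_map K (cot_point y) = y"
    by (simp_all add: cot_point_def)
  show "chart_inv K (chart_map K (cot_point y)) = cot_point y" unfolding *(2) by (simp add: cot_point_def)
  show "momentum \<A> \<kappa> (cot_point y) = snd y" using arg_cong[OF *(2), of snd] by (simp add: cot_chart_def)
  have "chart_map \<kappa> (fst (cot_point y)) = fst y" using arg_cong[OF *(2), of fst] by (simp add: cot_chart_def)
  moreover have "fst (cot_point y) \<in> chart_dom \<kappa>" using *(1) by (simp add: cot_chart_def)
  ultimately show "fst (cot_point y) = chart_inv \<kappa> (fst y)" using chart_inv_chart_map[OF X \<kappa>] by metis
qed

lemma cot_point_in_carrier: "fst y \<in> U \<Longrightarrow> cot_point y \<in> carrier_of (cot_atlas \<A>)"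
  using cot_point(1) \<kappa> unfolding carrier_of_def cot_atlas_def by blast

lemma metric_at_cot_point:
  assumes "fst y \<in> U"
  shows "metric_mat \<A> g \<kappa> (fst (cot_point y)) = M (fst y)"
    and "metric_inv \<A> g \<kappa> (fst (cot_point y)) = matrix_inv (M (fst y))"
    and "g_up0 \<A> g \<kappa> (cot_point y) i = raise M y $ i"
    and "energy \<A> g \<kappa> (cot_point y) = kinetic M y"
proof -
  show m: "metric_mat \<A> g \<kappa> (fst (cot_point y)) = M (fst y)"
    by (simp add: cot_point(4)[OF assms] metric_coord_def)
  then show i: "metric_inv \<A> g \<kappa> (fst (cot_point y)) = matrix_inv (M (fst y))"
    by (simp add: metric_inv_def)
  have "matrix_inv (M (fst y)) $ k $ l = matrix_inv (M (fst y)) $ l $ k" for k l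
    using arg_cong[OF matrix_inv_symmetric[OF M_invertible M_symmetric, OF assms assms], of "\<lambda>A. A $ l $ k"]
    by (simp add: transpose_def)
  then show "g_up0 \<A> g \<kappa> (cot_point y) i = raise M y $ i"
    by (simp add: g_up0_def i raise_def cot_point(5)[OF assms] matrix_vector_mult_def mult.commute)
  show "energy \<A> g \<kappa> (cot_point y) = kinetic M y"
    by (simp add: energy_def i raise_def kinetic_def cot_point(5)[OF assms] matrix_vector_mult_def
        inner_vec_def sum_distrib_left sum_distrib_right mult_ac)
qed

text \<open>
  The adapted frame as one family, horizontal fields first, indexed by a sum type so that the
  bilinear expansion has to be carried out only once.
\<close>

definition frame :: "(real^'n) \<times> (real^'n) \<Rightarrow> 'n + 'n \<Rightarrow> 'm cot tvec" where
  "frame y = case_sum (\<lambda>i. delta_q \<A> g \<kappa> i (cot_point y)) (\<lambda>i. d_p \<A> \<kappa> i (cot_point y))"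

text \<open>
  The components \<open>\<delta>p\<^sub>h(v)\<close>, that is, the coefficients of \<open>\<partial>/\<partial>p\<^sub>h\<close> in the adapted frame.
\<close>

definition vertical_part :: "(real^'n) \<times> (real^'n) \<Rightarrow> (real^'n) \<times> (real^'n) \<Rightarrow> real^'n" where
  "vertical_part y v = snd v - conn y *v fst v"

lemma delta_q_cot_point:
  assumes "fst y \<in> U"
  shows "delta_q \<A> g \<kappa> i (cot_point y)
    = (\<lambda>f. d_q \<A> \<kappa> i (cot_point y) f + (\<Sum>h\<in>UNIV. conn y $ i $ h * d_p \<A> \<kappa> h (cot_point y) f))"
proof
  fix f
  show "delta_q \<A> g \<kappa> i (cot_point y) f
    = d_q \<A> \<kappa> i (cot_point y) f + (\<Sum>h\<in>UNIV. conn y $ i $ h * d_p \<A> \<kappa> h (cot_point y) f)"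
    unfolding delta_q_def conn_def cot_point(4,5)[OF assms] vec_lambda_beta sum_distrib_right
    by (subst sum.swap) simp
qed

lemma coord_vec_cot_tangent:
  "fst y \<in> U \<Longrightarrow> coord_vec (cot_atlas \<A>) K (cot_point y) v \<in> tangent_space (cot_atlas \<A>) (cot_point y)"
  using \<kappa> by (intro coord_vec_in_tangent_space cot_point) (auto simp: cot_atlas_def)

lemma frame_tangent:
  assumes "fst y \<in> U"
  shows "frame y s \<in> tangent_space (cot_atlas \<A>) (cot_point y)"
proof (cases s)
  case (Inl i)
  have dp: "d_p \<A> \<kappa> h (cot_point y) \<in> tangent_space (cot_atlas \<A>) (cot_point y)" for h
    unfolding d_p_def by (rule coord_vec_cot_tangent[OF assms])
  have dq: "d_q \<A> \<kappa> i (cot_point y) \<in> tangent_space (cot_atlas \<A>) (cot_point y)"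
    unfolding d_q_def by (rule coord_vec_cot_tangent[OF assms])
  have "(\<lambda>f. \<Sum>h\<in>UNIV. conn y $ i $ h * d_p \<A> \<kappa> h (cot_point y) f) \<in> tangent_space (cot_atlas \<A>) (cot_point y)"
    by (rule tangent_space_sum[OF finite dp])
  from tangent_space_combine[OF dq this, of 1 1] show ?thesis
    by (simp add: Inl frame_def delta_q_cot_point[OF assms])
next
  case (Inr i)
  then show ?thesis using coord_vec_cot_tangent[OF assms] by (simp add: frame_def d_p_def)
qed

lemma coord_vec_frame:
  assumes y: "fst y \<in> U"
  shows "coord_vec (cot_atlas \<A>) K (cot_point y) v
    = lincomb (case_sum (($) (fst v)) (($) (vertical_part y v))) (frame y)"
proof
  fix f
  let ?z = "cot_point y"
  have "cot_chart \<A> \<kappa> \<in> cot_atlas \<A>" using \<kappa> by (simp add: cot_atlas_def)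
  then interpret linear "\<lambda>v. coord_vec (cot_atlas \<A>) K ?z v f"
    by (rule linear_coord_vec) (rule cot_point[OF y])
  have basis: "(\<Sum>i\<in>UNIV. a $ i *\<^sub>R axis i 1) = a" for a :: "real^'n"
    using basis_expansion[of a] by (simp add: scalar_mult_eq_scaleR)
  have v: "v = (\<Sum>i\<in>UNIV. fst v $ i *\<^sub>R (axis i 1, 0)) + (\<Sum>i\<in>UNIV. snd v $ i *\<^sub>R (0, axis i 1))"
    by (simp add: prod_eq_iff fst_sum snd_sum basis)
  have "coord_vec (cot_atlas \<A>) K ?z v f
      = (\<Sum>i\<in>UNIV. fst v $ i * d_q \<A> \<kappa> i ?z f) + (\<Sum>i\<in>UNIV. snd v $ i * d_p \<A> \<kappa> i ?z f)"
    using arg_cong[OF v, of "\<lambda>v. coord_vec (cot_atlas \<A>) K ?z v f"]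
    by (simp only: add sum scale real_scaleR_def d_q_def d_p_def)
  moreover have "(\<Sum>i\<in>UNIV. fst v $ i * (\<Sum>h\<in>UNIV. conn y $ i $ h * d_p \<A> \<kappa> h ?z f))
      = (\<Sum>h\<in>UNIV. (conn y *v fst v) $ h * d_p \<A> \<kappa> h ?z f)"
    unfolding sum_distrib_left
    by (subst sum.swap) (simp add: matrix_vector_mult_def sum_distrib_left sum_distrib_right conn_symmetric[OF y, of _ _] mult_ac)
  ultimately show "coord_vec (cot_atlas \<A>) K ?z v f
      = lincomb (case_sum (($) (fst v)) (($) (vertical_part y v))) (frame y) f"
    by (simp add: lincomb_def sum_UNIV_Plus frame_def delta_q_cot_point[OF y] vertical_part_def
        algebra_simps sum.distrib sum_subtractf)
qed

text \<open>
  This is \<open>g\<^sup>0\<^sup>h \<delta>p\<^sub>h = dt\<close>: the energy is constant along horizontal vectors.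
\<close>

lemma raise_vertical_part:
  assumes "fst y \<in> U"
  shows "raise M y \<bullet> vertical_part y v = kinetic_deriv M M' y v"
  by (simp add: vertical_part_def kinetic_deriv_def inner_diff_right raise_conn[OF assms])

text \<open>
  This is \<open>\<delta>p\<^sub>i \<and> dq\<^sup>i = dp\<^sub>i \<and> dq\<^sup>i\<close>, which holds because the Christoffel symbols are symmetric.
\<close>

lemma symplectic_vertical_part:
  assumes "fst y \<in> U"
  shows "vertical_part y v \<bullet> fst w - fst v \<bullet> vertical_part y w = symplectic v w"
proof -
  have "transpose (conn y) = conn y"
    using conn_symmetric[OF assms] by (simp add: transpose_def vec_eq_iff)
  then have "(conn y *v a) \<bullet> b = a \<bullet> (conn y *v b)" for a b
    by (metis dot_lmul_matrix transpose_matrix_vector)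
  then show ?thesis by (simp add: vertical_part_def symplectic_def inner_diff_left inner_diff_right)
qed

end

section \<open>The fundamental form\<close>

lemma almost_complex_structure_lincomb:
  assumes J: "almost_complex_structure \<A> J" and x: "x \<in> carrier_of \<A>"
    and W: "\<And>i. W i \<in> tangent_space \<A> x"
  shows "J x (lincomb a W) f = (\<Sum>i\<in>UNIV. a i * J x (W i) f)"
proof -
  have "J x (\<lambda>f. a * v f + b * w f) = (\<lambda>f. a * J x v f + b * J x w f)"
    if "v \<in> tangent_space \<A> x" "w \<in> tangent_space \<A> x" for v w a b
    using J x that unfolding almost_complex_structure_def by blast
  then have "linear_form_on (tangent_space \<A> x) (\<lambda>v. J x v f)"
    unfolding linear_form_on_def by simp
  from linear_form_on_lincomb[OF this W] show ?thesis .
qed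

context riemannian_chart begin

text \<open>
  With arbitrary scalars in the formulas for \<open>G\<close> and \<open>J\<close>, the mixed blocks of \<open>\<phi>\<close> have the form
  \<open>l \<delta>\<^sup>i\<^sub>j + m g\<^sup>0\<^sup>i p\<^sub>j\<close> as \<open>g\<^sub>i\<^sub>j\<close> is paired with its inverse and \<open>p\<close> with \<open>g\<^sup>0\<^sup>i\<close>; the pairing of
  \<open>p\<close> with \<open>g\<^sup>0\<^sup>i\<close> is \<open>2t\<close>. The two conditions for \<open>l\<close> and the two for \<open>m\<close> come from the two mixed blocks,
  which have to be opposite to each other.
\<close>

lemma fundamental_form_cot:
  assumes G: "riemannian_metric (cot_atlas \<A>) G" and J: "almost_complex_structure (cot_atlas \<A>) J"
    and y: "fst y \<in> U"
    and Jq: "\<And>i. J (cot_point y) (delta_q \<A> g \<kappa> i (cot_point y))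
      = lincomb (\<lambda>j. a1 * M (fst y) $ i $ j + b1 * snd y $ i * snd y $ j) (\<lambda>j. d_p \<A> \<kappa> j (cot_point y))"
    and Jp: "\<And>i. J (cot_point y) (d_p \<A> \<kappa> i (cot_point y))
      = lincomb (\<lambda>j. - (a2 * matrix_inv (M (fst y)) $ i $ j + b2 * raise M y $ i * raise M y $ j))
          (\<lambda>j. delta_q \<A> g \<kappa> j (cot_point y))"
    and Gqq: "\<And>i j. G (cot_point y) (delta_q \<A> g \<kappa> i (cot_point y)) (delta_q \<A> g \<kappa> j (cot_point y))
      = c1 * M (fst y) $ i $ j + d1 * snd y $ i * snd y $ j"
    and Gpp: "\<And>i j. G (cot_point y) (d_p \<A> \<kappa> i (cot_point y)) (d_p \<A> \<kappa> j (cot_point y))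
      = c2 * matrix_inv (M (fst y)) $ i $ j + d2 * raise M y $ i * raise M y $ j"
    and Gpq: "\<And>i j. G (cot_point y) (d_p \<A> \<kappa> i (cot_point y)) (delta_q \<A> g \<kappa> j (cot_point y)) = 0"
    and l: "c1 * a2 = l" "c2 * a1 = l"
    and m: "c2 * b1 + d2 * a1 + d2 * b1 * (2 * kinetic M y) = m"
      "c1 * b2 + d1 * a2 + d1 * b2 * (2 * kinetic M y) = m"
  shows "fundamental_form G J (cot_point y) (coord_vec (cot_atlas \<A>) K (cot_point y) v)
      (coord_vec (cot_atlas \<A>) K (cot_point y) w)
    = l * symplectic v w + m * (kinetic_deriv M M' y v * (snd y \<bullet> fst w) - kinetic_deriv M M' y w * (snd y \<bullet> fst v))"
proof -
  let ?z = "cot_point y" and ?N = "matrix_inv (M (fst y))"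
  let ?p = "snd y" and ?u = "raise M y" and ?V = "vertical_part y"
  note z = cot_point_in_carrier[OF y]
  note fr = frame_tangent[OF y]
  have frame: "frame y (Inl i) = delta_q \<A> g \<kappa> i ?z" "frame y (Inr i) = d_p \<A> \<kappa> i ?z" for i
    by (simp_all add: frame_def)
  have N: "transpose ?N = ?N" by (rule matrix_inv_symmetric[OF M_invertible M_symmetric, OF y y])
  \<comment> \<open>The vertical and horizontal components of \<open>J\<close> applied to the coordinate vector of \<open>w\<close>.\<close>
  define \<alpha> where "\<alpha> = a1 *\<^sub>R (M (fst y) *v fst w) + (b1 * (fst w \<bullet> ?p)) *\<^sub>R ?p"
  define \<beta> where "\<beta> = - (a2 *\<^sub>R (?N *v ?V w) + (b2 * (?V w \<bullet> ?u)) *\<^sub>R ?u)"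
  have \<alpha>: "\<alpha> $ k = (\<Sum>j\<in>UNIV. fst w $ j * (a1 * M (fst y) $ j $ k + b1 * ?p $ j * ?p $ k))" for k
    unfolding \<alpha>_def scaled_rank_one_update_mult[OF M_symmetric[OF y], symmetric] by simp
  have \<beta>: "\<beta> $ k = - (\<Sum>j\<in>UNIV. ?V w $ j * (a2 * ?N $ j $ k + b2 * ?u $ j * ?u $ k))" for k
    unfolding \<beta>_def scaled_rank_one_update_mult[OF N, symmetric] by simp
  have Jw: "J ?z (coord_vec (cot_atlas \<A>) K ?z w) = lincomb (case_sum (($) \<beta>) (($) \<alpha>)) (frame y)"
  proof
    fix f
    have "J ?z (coord_vec (cot_atlas \<A>) K ?z w) f
        = (\<Sum>j\<in>UNIV. fst w $ j * (\<Sum>k\<in>UNIV. (a1 * M (fst y) $ j $ k + b1 * ?p $ j * ?p $ k) * d_p \<A> \<kappa> k ?z f))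
          + (\<Sum>j\<in>UNIV. ?V w $ j * (\<Sum>k\<in>UNIV. - (a2 * ?N $ j $ k + b2 * ?u $ j * ?u $ k) * delta_q \<A> g \<kappa> k ?z f))"
      unfolding coord_vec_frame[OF y] almost_complex_structure_lincomb[OF J z fr] sum_UNIV_Plus
      by (simp add: frame Jq Jp lincomb_def)
    also have "\<dots> = (\<Sum>k\<in>UNIV. \<alpha> $ k * d_p \<A> \<kappa> k ?z f) + (\<Sum>k\<in>UNIV. \<beta> $ k * delta_q \<A> g \<kappa> k ?z f)"
      unfolding \<alpha> \<beta> sum_distrib_left sum_distrib_right sum_negf[symmetric]
      by (intro arg_cong2[where f = "(+)"]; subst sum.swap; intro sum.cong refl) (simp_all add: algebra_simps)
    also have "\<dots> = lincomb (case_sum (($) \<beta>) (($) \<alpha>)) (frame y) f"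
      by (simp add: lincomb_def sum_UNIV_Plus frame)
    finally show "J ?z (coord_vec (cot_atlas \<A>) K ?z w) f = \<dots>" .
  qed
  have Gqp: "G ?z (delta_q \<A> g \<kappa> i ?z) (d_p \<A> \<kappa> j ?z) = 0" for i j
    using riemannian_metricD(2)[OF G z fr[of "Inl i"] fr[of "Inr j"]] by (simp add: frame Gpq)
  have "fundamental_form G J ?z (coord_vec (cot_atlas \<A>) K ?z v) (coord_vec (cot_atlas \<A>) K ?z w)
      = (\<Sum>i\<in>UNIV. \<Sum>k\<in>UNIV. fst v $ i * \<beta> $ k * (c1 * M (fst y) $ i $ k + d1 * ?p $ i * ?p $ k))
        + (\<Sum>i\<in>UNIV. \<Sum>k\<in>UNIV. ?V v $ i * \<alpha> $ k * (c2 * ?N $ i $ k + d2 * ?u $ i * ?u $ k))"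
    unfolding fundamental_form_def Jw coord_vec_frame[OF y, of v] bilinear_lincomb[OF G z fr fr] sum_UNIV_Plus
    by (simp add: frame Gqq Gpp Gpq Gqp)
  also have "\<dots> = c1 * (fst v \<bullet> (M (fst y) *v \<beta>)) + d1 * (fst v \<bullet> ?p) * (\<beta> \<bullet> ?p)
      + (c2 * (?V v \<bullet> (?N *v \<alpha>)) + d2 * (?V v \<bullet> ?u) * (\<alpha> \<bullet> ?u))"
    unfolding sum_scaled_rank_one_update ..
  finally have *: "fundamental_form G J ?z (coord_vec (cot_atlas \<A>) K ?z v) (coord_vec (cot_atlas \<A>) K ?z w) = \<dots>" .
  have 2: "?u \<bullet> ?p = 2 * kinetic M y" by (simp add: kinetic_def)
  have NM: "?N *v (M (fst y) *v a) = a" "M (fst y) *v (?N *v a) = a" for a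
    by (simp_all add: matrix_vector_mul_assoc matrix_inv_inverse M_invertible[OF y])
  have Np: "?N *v ?p = ?u" by (simp add: raise_def)
  have sym: "(A *v a) \<bullet> b = a \<bullet> (A *v b)" if "transpose A = A" for A :: "real^'n^'n" and a b
    using that by (metis dot_lmul_matrix transpose_matrix_vector)
  note lin = linear_add[OF matrix_vector_mul_linear] linear_scale[OF matrix_vector_mul_linear]
    linear_neg[OF matrix_vector_mul_linear]
  have e1: "M (fst y) *v \<beta> = - (a2 *\<^sub>R ?V w + (b2 * (?V w \<bullet> ?u)) *\<^sub>R ?p)"
    unfolding \<beta>_def lin NM M_raise[OF y] ..
  have e2: "\<beta> \<bullet> ?p = - (a2 * (?V w \<bullet> ?u) + b2 * (?V w \<bullet> ?u) * (2 * kinetic M y))"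
    unfolding \<beta>_def inner_minus_left inner_add_left inner_scaleR_left sym[OF N] Np 2 ..
  have e3: "?N *v \<alpha> = a1 *\<^sub>R fst w + (b1 * (fst w \<bullet> ?p)) *\<^sub>R ?u"
    unfolding \<alpha>_def lin NM Np ..
  have e4: "\<alpha> \<bullet> ?u = a1 * (fst w \<bullet> ?p) + b1 * (fst w \<bullet> ?p) * (2 * kinetic M y)"
    unfolding \<alpha>_def by (simp add: inner_add_left sym[OF M_symmetric[OF y]] M_raise[OF y] 2[unfolded inner_commute[of ?u]])
  have "fundamental_form G J ?z (coord_vec (cot_atlas \<A>) K ?z v) (coord_vec (cot_atlas \<A>) K ?z w)
     = (c2 * a1) * (?V v \<bullet> fst w) - (c1 * a2) * (fst v \<bullet> ?V w)
     + (c2 * b1 + d2 * a1 + d2 * b1 * (2 * kinetic M y)) * (?u \<bullet> ?V v) * (?p \<bullet> fst w)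
     - (c1 * b2 + d1 * a2 + d1 * b2 * (2 * kinetic M y)) * (?u \<bullet> ?V w) * (?p \<bullet> fst v)"
    unfolding * e1 e2 e3 e4 inner_add_right inner_minus_right inner_scaleR_right
    by (simp add: inner_commute algebra_simps)
  also have "\<dots> = l * (?V v \<bullet> fst w - fst v \<bullet> ?V w)
      + m * ((?u \<bullet> ?V v) * (?p \<bullet> fst w) - (?u \<bullet> ?V w) * (?p \<bullet> fst v))"
    unfolding l m by (simp add: algebra_simps)
  finally show ?thesis
    unfolding symplectic_vertical_part[OF y] raise_vertical_part[OF y] .
qed

end

text \<open>
  With indices moved by the metric, the two blocks of \<open>J\<close> act on the line spanned by \<open>p\<close>
  by \<open>B / (A L)\<close> and \<open>A L / B\<close>, by the one relation \<open>A\<^sup>2 L - 2 t K = l B\<close>. With these values both equations for \<open>m\<close> become trivial.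
\<close>

lemma fundamental_form_scalars:
  fixes A c l l' m t :: real
  defines "L \<equiv> l + 2 * t * l'" and "B \<equiv> A^2 - 2 * c * t * l^2" and "K \<equiv> c * l^3 + A^2 * l'"
  assumes "A > 0" "l > 0" "B / L > 0"
  shows "l^2 / A * (- (K / (A * l * L))) + (l * K + m * A^2 * L) / (A * B) * (A / l)
      + (l * K + m * A^2 * L) / (A * B) * (- (K / (A * l * L))) * (2 * t) = m"
    and "A * (K / (A * B)) + (- K + m * B) / (A * L) * (l / A)
      + (- K + m * B) / (A * L) * (K / (A * B)) * (2 * t) = m"
proof -
  have nz: "A \<noteq> 0" "l \<noteq> 0" "L \<noteq> 0" "B \<noteq> 0" using assms(4-6) by auto
  have rel: "A^2 * L - 2 * t * K = l * B"
    unfolding L_def B_def K_def by (simp add: algebra_simps power2_eq_square power3_eq_cube)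
  have a: "A / l + - (K / (A * l * L)) * (2 * t) = B / (A * L)"
  proof -
    have "A / l + - (K / (A * l * L)) * (2 * t) = (A^2 * L - 2 * t * K) / (A * l * L)"
      using nz by (simp add: field_simps power2_eq_square)
    then show ?thesis unfolding rel using nz by simp
  qed
  have b: "l / A + K / (A * B) * (2 * t) = A * L / B"
  proof -
    have "l / A + K / (A * B) * (2 * t) = (l * B + 2 * t * K) / (A * B)"
      using nz by (simp add: field_simps)
    also have "l * B + 2 * t * K = A^2 * L" using rel by simp
    finally show ?thesis using nz by (simp add: power2_eq_square)
  qed
  have "l^2 / A * (- (K / (A * l * L))) + (l * K + m * A^2 * L) / (A * B) * (A / l + - (K / (A * l * L)) * (2 * t)) = m"
    unfolding a using nz by (simp add: field_simps power2_eq_square)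
  then show "l^2 / A * (- (K / (A * l * L))) + (l * K + m * A^2 * L) / (A * B) * (A / l)
      + (l * K + m * A^2 * L) / (A * B) * (- (K / (A * l * L))) * (2 * t) = m"
    by (simp only: distrib_left mult.assoc add.assoc)
  have "A * (K / (A * B)) + (- K + m * B) / (A * L) * (l / A + K / (A * B) * (2 * t)) = m"
    unfolding b using nz by (simp add: field_simps)
  then show "A * (K / (A * B)) + (- K + m * B) / (A * L) * (l / A)
      + (- K + m * B) / (A * L) * (K / (A * B)) * (2 * t) = m"
    by (simp only: distrib_left mult.assoc add.assoc)
qed

section \<open>Closedness of the fundamental form\<close>

context riemannian_chart begin

lemma kinetic_nonneg_M: "fst y \<in> U \<Longrightarrow> 0 \<le> kinetic M y"
  by (rule kinetic_nonneg) (simp_all add: M_invertible M_pos)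

text \<open>
  A multiple of the covector dual to any nonzero vector.
\<close>

lemma exists_momentum_with_energy:
  assumes "q \<in> U" "t \<ge> 0"
  shows "\<exists>p. kinetic M (q, p) = t"
proof -
  obtain a :: "real^'n" where "a \<noteq> 0" using zero_neq_one by metis
  define k where "k = a \<bullet> (M q *v a)"
  have k: "k > 0" unfolding k_def by (rule M_pos) fact+
  define s where "s = sqrt (2 * t / k)"
  have s: "s * s * k = 2 * t" using k assms(2) by (simp add: s_def)
  have "raise M (q, s *\<^sub>R (M q *v a)) = s *\<^sub>R a"
    by (simp add: raise_def matrix_vector_mult_scaleR matrix_vector_mul_assoc matrix_inv_inverse M_invertible assms)
  then have "kinetic M (q, s *\<^sub>R (M q *v a)) = t"
    using s by (simp add: kinetic_def k_def mult.assoc)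
  then show ?thesis ..
qed

text \<open>
  The 3-form is evaluated on the Liouville direction \<open>a = p \<partial>/\<partial>p\<close>, along which \<open>dt = 2t\<close>, and on
  \<open>b = (r, 0)\<close>, \<open>e = (0, r)\<close>. If \<open>r\<close> is orthogonal to \<open>g\<^sup>0\<^sup>i\<close> then only the term \<open>dt(a) d\<theta>(b, e)\<close> survives;
  a nonzero such \<open>r\<close> exists since the dimension is greater than one.
\<close>

lemma energy_wedge_symplectic_nonzero:
  assumes y: "fst y \<in> U" and "kinetic M y \<noteq> 0" and n: "CARD('n) > 1"
  shows "\<exists>a b e. kinetic_deriv M M' y a * symplectic b e + kinetic_deriv M M' y b * symplectic e a
    + kinetic_deriv M M' y e * symplectic a b \<noteq> 0"
proof -
  have "2 \<le> DIM(real^'n)" using n by simp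
  then obtain r :: "real^'n" where r: "r \<noteq> 0" "orthogonal (raise M y) r"
    by (rule orthogonal_to_vector_exists)
  have "M' (fst y) 0 = 0" using has_derivative_linear[OF M_deriv[OF y]] by (rule linear_0)
  then have vert: "kinetic_deriv M M' y (0, b) = raise M y \<bullet> b" for b
    by (simp add: kinetic_deriv_def)
  have "kinetic_deriv M M' y (0, snd y) * symplectic (r, 0) (0, r)
    + kinetic_deriv M M' y (r, 0) * symplectic (0, r) (0, snd y)
    + kinetic_deriv M M' y (0, r) * symplectic (0, snd y) (r, 0) = - (2 * kinetic M y * (r \<bullet> r))"
    using r(2) by (simp add: vert symplectic_def orthogonal_def kinetic_def)
  moreover have "\<dots> \<noteq> 0" using assms(2) r(1) by simp
  ultimately show ?thesis by metis
qed

lemma ext_deriv2_cot: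
  assumes x: "x \<in> chart_dom K"
    and \<phi>: "\<And>y v w. fst y \<in> U \<Longrightarrow>
      \<phi> (cot_point y) (coord_vec (cot_atlas \<A>) K (cot_point y) v) (coord_vec (cot_atlas \<A>) K (cot_point y) w)
      = lam (kinetic M y) * symplectic v w + mu (kinetic M y) *
        (kinetic_deriv M M' y v * (snd y \<bullet> fst w) - kinetic_deriv M M' y w * (snd y \<bullet> fst v))"
    and lam: "\<And>t. t \<ge> 0 \<Longrightarrow> (lam has_real_derivative lam' t) (at t within {0..})"
    and mu: "\<And>t. t \<ge> 0 \<Longrightarrow> (mu has_real_derivative mu' t) (at t within {0..})"
    and y: "y = chart_map K x"
  shows "ext_deriv2 (cot_atlas \<A>) K \<phi> x a b e = (lam' (kinetic M y) - mu (kinetic M y)) *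
    (kinetic_deriv M M' y a * symplectic b e + kinetic_deriv M M' y b * symplectic e a
      + kinetic_deriv M M' y e * symplectic a b)"
proof -
  let ?S = "U \<times> (UNIV :: (real^'n) set)"
  have "y \<in> chart_img K" unfolding chart_img_def y by (rule imageI[OF x])
  then have yS: "y \<in> ?S" unfolding cot_chart_img .
  then have fy: "fst y \<in> U" by auto
  define F where "F = (\<lambda>v w y. \<phi> (cot_point y)
    (coord_vec (cot_atlas \<A>) K (cot_point y) v) (coord_vec (cot_atlas \<A>) K (cot_point y) w))"
  have "ext_deriv2 (cot_atlas \<A>) K \<phi> x a b e = frechet_derivative (F b e) (at y) a
      + frechet_derivative (F e a) (at y) b + frechet_derivative (F a b) (at y) e"
    by (simp add: ext_deriv2_def chart_deriv_def o_def F_def cot_point_def y)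
  also have "\<dots> = (lam' (kinetic M y) - mu (kinetic M y)) *
    (kinetic_deriv M M' y a * symplectic b e + kinetic_deriv M M' y b * symplectic e a
      + kinetic_deriv M M' y e * symplectic a b)"
  proof (rule ext_deriv_energy_form[where S = ?S and T = "kinetic M" and T' = "kinetic_deriv M M'"
        and lam = lam and mu = mu and m' = "mu' (kinetic M y)"])
    show "open ?S" by (intro open_Times open_U open_UNIV)
    show "(kinetic M has_derivative kinetic_deriv M M' y) (at y)" if "y \<in> ?S" for y
      by (rule has_derivative_kinetic[OF open_U M_deriv M_invertible M_symmetric]) (use that in auto)
    show "(\<lambda>y. kinetic_deriv M M' y v) differentiable (at y)" for v
      by (rule kinetic_deriv_differentiable[OF open_U M_deriv M_invertible M_symmetric fy
            metric_deriv_differentiable[OF X g \<kappa> fy]])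
    show "0 \<le> kinetic M y" if "y \<in> ?S" for y using that kinetic_nonneg_M by auto
    show "F v w y = lam (kinetic M y) * symplectic v w + mu (kinetic M y) *
        (kinetic_deriv M M' y v * (snd y \<bullet> fst w) - kinetic_deriv M M' y w * (snd y \<bullet> fst v))"
      if "y \<in> ?S" for v w y
      unfolding F_def by (rule \<phi>) (use that in auto)
  qed (use yS lam mu kinetic_nonneg_M[OF fy] in auto)
  finally show ?thesis .
qed

end

lemma at_within_half_line_neq_bot:
  assumes "t \<ge> (0::real)"
  shows "at t within {0..} \<noteq> bot"
proof -
  have "at_right t \<le> at t within {0..}" by (rule at_le) (use assms in auto)
  then show ?thesis using trivial_limit_at_right_real[of t] by (metis bot.extremum_uniqueI)
qed

lemma has_half_deriv:
  assumes "smooth_on {0..} f" "t \<ge> 0"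
  shows "(f has_real_derivative half_deriv f t) (at t within {0..})"
proof -
  have "f differentiable (at t within {0..})"
    using assms(1)[unfolded smooth_on_def, rule_format, of "Suc 0"] assms(2) by simp
  then show ?thesis
    unfolding has_real_derivative_iff_has_vector_derivative half_deriv_def vector_derivative_works .
qed

lemma continuous_on_half_deriv:
  assumes "smooth_on {0..} f"
  shows "continuous_on {0..} (half_deriv f)"
proof -
  have *: "continuous_on {0..} (\<lambda>t. frechet_derivative f (at t within {0..}) 1)"
    using assms[unfolded smooth_on_def, rule_format, of "Suc 0"] by simp
  have "frechet_derivative f (at t within {0..}) 1 = half_deriv f t" if "t \<in> {0..}" for t
  proof -
    have t: "t \<ge> 0" using that by simp
    have "f differentiable (at t within {0..})"
      using assms(1)[unfolded smooth_on_def, rule_format, of "Suc 0"] t by simp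
    then have D: "(f has_derivative frechet_derivative f (at t within {0..})) (at t within {0..})"
      unfolding frechet_derivative_works .
    have "(f has_vector_derivative frechet_derivative f (at t within {0..}) 1) (at t within {0..})"
    proof -
      have eq: "frechet_derivative f (at t within {0..}) = (\<lambda>h. h *\<^sub>R frechet_derivative f (at t within {0..}) 1)"
        (is "?D = _")
      proof
        show "?D h = h *\<^sub>R ?D 1" for h
          using linear_scale[OF has_derivative_linear[OF D], of h 1] by simp
      qed
      show ?thesis unfolding has_vector_derivative_def eq[symmetric] by (rule D)
    qed
    from vector_derivative_within[OF at_within_half_line_neq_bot[OF t] this] show ?thesis
      by (simp add: half_deriv_def)
  qed
  then have "continuous_on {0..} (\<lambda>t. frechet_derivative f (at t within {0..}) 1)
      \<longleftrightarrow> continuous_on {0..} (half_deriv f)"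
    by (rule continuous_on_cong[OF refl])
  with * show ?thesis by blast
qed

theorem theorem7:
  fixes X :: "'m topology" and \<A> :: "('m, real^'n) chart set"
    and g :: "'m bilin_field" and c A :: real and lam mu :: "real \<Rightarrow> real"
    and G :: "'m cot bilin_field" and J :: "'m cot \<Rightarrow> 'm cot tvec \<Rightarrow> 'm cot tvec"
  assumes "smooth_manifold X \<A>"
    and "CARD('n) > 1"
    and "riemannian_metric \<A> g"
    and "constant_sectional_curvature \<A> g c"
    and "A > 0"
    and "smooth_on {0..} lam" and "smooth_on {0..} mu"
    and "\<And>t. t \<ge> 0 \<Longrightarrow> lam t > 0"
    and "\<And>t. t \<ge> 0 \<Longrightarrow>
      (A^2 - 2 * c * t * (lam t)^2) / (lam t + 2 * t * half_deriv lam t) > 0"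
    and "\<And>t. t \<ge> 0 \<Longrightarrow> lam t + 2 * t * mu t > 0"
    and "hermitian_structure (cot_atlas \<A>) G J"
    and "\<And>\<kappa> z i. \<kappa> \<in> \<A> \<Longrightarrow> z \<in> chart_dom (cot_chart \<A> \<kappa>) \<Longrightarrow>
      J z (delta_q \<A> g \<kappa> i z)
        = lincomb (\<lambda>j. J1_coef \<A> g c A lam \<kappa> z i j) (\<lambda>j. d_p \<A> \<kappa> j z)"
    and "\<And>\<kappa> z i. \<kappa> \<in> \<A> \<Longrightarrow> z \<in> chart_dom (cot_chart \<A> \<kappa>) \<Longrightarrow>
      J z (d_p \<A> \<kappa> i z)
        = lincomb (\<lambda>j. - J2_coef \<A> g c A lam \<kappa> z i j) (\<lambda>j. delta_q \<A> g \<kappa> j z)"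
    and "\<And>\<kappa> z i j. \<kappa> \<in> \<A> \<Longrightarrow> z \<in> chart_dom (cot_chart \<A> \<kappa>) \<Longrightarrow>
      G z (delta_q \<A> g \<kappa> i z) (delta_q \<A> g \<kappa> j z)
        = c1_coef A * metric_mat \<A> g \<kappa> (fst z) $ i $ j
          + d1_coef c A lam mu (energy \<A> g \<kappa> z) * momentum \<A> \<kappa> z $ i * momentum \<A> \<kappa> z $ j"
    and "\<And>\<kappa> z i j. \<kappa> \<in> \<A> \<Longrightarrow> z \<in> chart_dom (cot_chart \<A> \<kappa>) \<Longrightarrow>
      G z (d_p \<A> \<kappa> i z) (d_p \<A> \<kappa> j z)
        = c2_coef A lam (energy \<A> g \<kappa> z) * metric_inv \<A> g \<kappa> (fst z) $ i $ j
          + d2_coef c A lam mu (energy \<A> g \<kappa> z) * g_up0 \<A> g \<kappa> z i * g_up0 \<A> g \<kappa> z j"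
    and "\<And>\<kappa> z i j. \<kappa> \<in> \<A> \<Longrightarrow> z \<in> chart_dom (cot_chart \<A> \<kappa>) \<Longrightarrow>
      G z (d_p \<A> \<kappa> i z) (delta_q \<A> g \<kappa> j z) = 0"
  shows "kaehler (cot_atlas \<A>) G J \<longleftrightarrow> (\<forall>t\<ge>0. mu t = half_deriv lam t)"
proof -
  note X = assms(1) and n = assms(2) and g = assms(3) and A = assms(5) and lam = assms(6) and mu = assms(7)
    and lam_pos = assms(8) and quot = assms(9) and herm = assms(11) and J_q = assms(12) and J_p = assms(13)
    and G_qq = assms(14) and G_pp = assms(15) and G_pq = assms(16)
  let ?\<phi> = "fundamental_form G J" and ?K = "cot_chart \<A>"
  have G: "riemannian_metric (cot_atlas \<A>) G" and J: "almost_complex_structure (cot_atlas \<A>) J"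
    using herm unfolding hermitian_structure_def by blast+
  \<comment> \<open>\<open>d\<phi> = (d\<lambda>/dt - \<mu>) dt \<and> d\<theta>\<close> in every cotangent chart.\<close>
  have d\<phi>: "ext_deriv2 (cot_atlas \<A>) (?K \<kappa>) ?\<phi> x a b e = (half_deriv lam t - mu t) *
      (kinetic_deriv (metric_coord \<A> g \<kappa>) (metric_deriv \<A> g \<kappa>) y a * symplectic b e
        + kinetic_deriv (metric_coord \<A> g \<kappa>) (metric_deriv \<A> g \<kappa>) y b * symplectic e a
        + kinetic_deriv (metric_coord \<A> g \<kappa>) (metric_deriv \<A> g \<kappa>) y e * symplectic a b)"
    if \<kappa>: "\<kappa> \<in> \<A>" and x: "x \<in> chart_dom (?K \<kappa>)" and y: "y = chart_map (?K \<kappa>) x"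
      and t: "t = kinetic (metric_coord \<A> g \<kappa>) y" for \<kappa> x a b e y t
  proof -
    interpret riemannian_chart X \<A> g \<kappa> by unfold_locales (rule X g \<kappa>)+
    show ?thesis unfolding t
    proof (rule ext_deriv2_cot[OF x _ has_half_deriv[OF lam] has_half_deriv[OF mu] y])
      fix y v w :: "(real^'n) \<times> (real^'n)"
      assume y: "fst y \<in> chart_img \<kappa>"
      let ?t = "kinetic M y"
      define l where "l = lam ?t"
      define l' where "l' = half_deriv lam ?t"
      define m where "m = mu ?t"
      have t: "?t \<ge> 0" by (rule kinetic_nonneg_M[OF y])
      note z = cot_point[OF y] and at_z = metric_at_cot_point[OF y]
      note scalars = fundamental_form_scalars[of A l c ?t l' m, OF A,
          unfolded l_def l'_def, OF lam_pos[OF t] quot[OF t], folded l_def l'_def]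
      have l: "l \<noteq> 0" using lam_pos[OF t] by (simp add: l_def)
      show "?\<phi> (cot_point y) (coord_vec (cot_atlas \<A>) K (cot_point y) v) (coord_vec (cot_atlas \<A>) K (cot_point y) w)
        = lam ?t * symplectic v w + mu ?t *
          (kinetic_deriv M M' y v * (snd y \<bullet> fst w) - kinetic_deriv M M' y w * (snd y \<bullet> fst v))"
        unfolding l_def[symmetric] m_def[symmetric]
      proof (rule fundamental_form_cot[OF G J y, where
            ?a1.0 = "A / l" and ?b1.0 = "- ((c * l^3 + A^2 * l') / (A * l * (l + 2 * ?t * l')))" and
            ?a2.0 = "l / A" and ?b2.0 = "(c * l^3 + A^2 * l') / (A * (A^2 - 2 * c * ?t * l^2))" and
            ?c1.0 = A and ?d1.0 = "(- (c * l^3 + A^2 * l') + m * (A^2 - 2 * c * ?t * l^2)) / (A * (l + 2 * ?t * l'))" and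
            ?c2.0 = "l^2 / A" and ?d2.0 = "(l * (c * l^3 + A^2 * l') + m * A^2 * (l + 2 * ?t * l')) / (A * (A^2 - 2 * c * ?t * l^2))"])
        show "J (cot_point y) (delta_q \<A> g \<kappa> i (cot_point y)) = lincomb (\<lambda>j. A / l * M (fst y) $ i $ j
            + - ((c * l^3 + A^2 * l') / (A * l * (l + 2 * ?t * l'))) * snd y $ i * snd y $ j)
            (\<lambda>j. d_p \<A> \<kappa> j (cot_point y))" for i
          unfolding J_q[OF \<kappa> z(1)]
          by (rule arg_cong2[where f = lincomb, OF _ refl], rule ext) (simp add: J1_coef_def Let_def at_z z(5) l_def l'_def)
        show "J (cot_point y) (d_p \<A> \<kappa> i (cot_point y)) = lincomb (\<lambda>j. - (l / A * matrix_inv (M (fst y)) $ i $ j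
            + (c * l^3 + A^2 * l') / (A * (A^2 - 2 * c * ?t * l^2)) * raise M y $ i * raise M y $ j))
            (\<lambda>j. delta_q \<A> g \<kappa> j (cot_point y))" for i
          unfolding J_p[OF \<kappa> z(1)]
          by (rule arg_cong2[where f = lincomb, OF _ refl], rule ext) (simp add: J2_coef_def Let_def at_z l_def l'_def)
        show "A * (l / A) = l" "l\<^sup>2 / A * (A / l) = l" using A l by (simp_all add: power2_eq_square)
      qed (rule scalars | simp add: G_qq[OF \<kappa> z(1)] G_pp[OF \<kappa> z(1)] G_pq[OF \<kappa> z(1)] c1_coef_def c2_coef_def
            d1_coef_def d2_coef_def Let_def at_z z(5) l_def l'_def m_def)+
    qed
  qed
  have "(\<forall>t\<ge>0. mu t = half_deriv lam t)" if closed: "closed_form2 (cot_atlas \<A>) ?\<phi>"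
  proof -
    obtain x \<kappa> where chart: "\<kappa> \<in> \<A>" "x \<in> chart_dom \<kappa>"
      using smooth_manifoldD(1,2)[OF X] unfolding carrier_of_def by blast
    interpret riemannian_chart X \<A> g \<kappa> by unfold_locales (rule X g chart)+
    have q: "chart_map \<kappa> x \<in> U" using chart(2) by (simp add: chart_img_def)
    have pos: "mu t - half_deriv lam t = 0" if t: "t \<in> {0<..}" for t
    proof -
      obtain p where p: "kinetic M (chart_map \<kappa> x, p) = t"
        using exists_momentum_with_energy[OF q, of t] t by auto
      define y where "y = (chart_map \<kappa> x, p)"
      have y: "fst y \<in> U" "kinetic M y = t" using p q by (simp_all add: y_def)
      obtain a b e where abe: "kinetic_deriv M M' y a * symplectic b e + kinetic_deriv M M' y b * symplectic e a
          + kinetic_deriv M M' y e * symplectic a b \<noteq> 0"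
        using energy_wedge_symplectic_nonzero[OF y(1) _ n] y(2) t by auto
      have "ext_deriv2 (cot_atlas \<A>) K ?\<phi> (cot_point y) a b e = 0"
        using closed cot_point(1)[OF y(1)] chart(1) unfolding closed_form2_def cot_atlas_def by blast
      with abe show ?thesis
        unfolding d\<phi>[OF chart(1) cot_point(1)[OF y(1)] cot_point(2)[OF y(1), symmetric] y(2)[symmetric]] by simp
    qed
    have "continuous_on (closure {0<..}) (\<lambda>t. mu t - half_deriv lam t)"
      unfolding closure_greaterThan
      using lam mu[unfolded smooth_on_def, rule_format, of 0]
      by (intro continuous_on_diff continuous_on_half_deriv) simp_all
    then have "mu t - half_deriv lam t = 0" if "t \<in> closure {0<..}" for t
      using continuous_constant_on_closure pos that by blast
    then show ?thesis by simp
  qed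
  moreover have "closed_form2 (cot_atlas \<A>) ?\<phi>" if "\<forall>t\<ge>0. mu t = half_deriv lam t"
    unfolding closed_form2_def cot_atlas_def
  proof (intro ballI allI)
    fix K x a b e assume "K \<in> ?K ` \<A>" and x: "x \<in> chart_dom K"
    then obtain \<kappa> where chart: "\<kappa> \<in> \<A>" "K = ?K \<kappa>" by blast
    interpret riemannian_chart X \<A> g \<kappa> by unfold_locales (rule X g chart)+
    have "chart_map (?K \<kappa>) x \<in> chart_img (?K \<kappa>)"
      unfolding chart_img_def by (rule imageI[OF x[unfolded chart(2)]])
    then have "kinetic M (chart_map (?K \<kappa>) x) \<ge> 0" unfolding cot_chart_img by (intro kinetic_nonneg_M) auto
    then show "ext_deriv2 (?K ` \<A>) K ?\<phi> x a b e = 0"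
      using d\<phi>[OF chart(1) x[unfolded chart(2)] refl refl, of a b e] that by (simp add: chart(2) cot_atlas_def)
  qed
  ultimately show ?thesis using herm unfolding kaehler_def by blast
qed

end
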